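(* Consider the problem of minimizing $P=P_1-P_2$ over $C\cap\mathscr{F}$ and suppose that Assumption A (stated in the context) holds. Let $\{x^k\}$ be generated by Algorithm ESQM$_{\rm e}$ (described in the context). Then for any accumulation point $\bar x$ of $\{x^k\}$, there exists $\bar\lambda_i\ge 0$ for each $i\in\tilde I(\bar x)$ such that $\sum_{i\in\tilde I(\bar x)}\bar\lambda_i=1$ and $$0\in\partial P_1(\bar x)-\partial P_2(\bar x)+\theta_{N_0}\sum_{i\in\tilde I(\bar x)}\bar\lambda_i\nabla g_i(\bar x)+\mathcal{N}_C(\bar x),$$ where $g_0:=0$, $\tilde I(\bar x):=\{\iota\in\{0,1,\ldots,m\}:g_\iota(\bar x)=\max_{i=0,1,\ldots,m}g_i(\bar x)\}$, and $\theta_{N_0}$ is the eventual constant value of $\{\theta_k\}$ (see the context). Moreover, $\bar x$ is a critical point of the problem.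
   Context: Problem. $P_1,P_2:\mathbb{R}^n\to\mathbb{R}$ are convex functions and $P:=P_1-P_2$; $g_1,\ldots,g_m:\mathbb{R}^n\to\mathbb{R}$ are differentiable with Lipschitz continuous gradients; $C\subseteq\mathbb{R}^n$ is a nonempty compact convex set; $\mathscr{F}:=\{x\in\mathbb{R}^n:g_i(x)\le 0,\ i=1,\ldots,m\}$ and $C\cap\mathscr{F}\ne\emptyset$. The problem is $\min\{P(x):x\in C\cap\mathscr{F}\}$. Constants. For each $i$ write $g_i=g_i^1-g_i^2$ with $g_i^1,g_i^2$ convex with Lipschitz continuous gradients; $L_{g_i}>0$ is a Lipschitz modulus of $\nabla g_i^1$, $\ell_{g_i}\ge 0$ is a Lipschitz modulus of $\nabla g_i^2$, and $L_{g_i}\ge\ell_{g_i}$. Set $L_g:=\max_{i=1,\ldots,m}L_{g_i}$ and $\ell_g:=\max_{i=1,\ldots,m}\ell_{g_i}$. Notation. $[t]_+:=\max\{t,0\}$ for $t\in\mathbb{R}$; $\|\cdot\|$ is the Euclidean norm; ${\rm lin}_{g_i}(u,w):=g_i(w)+\langle\nabla g_i(w),u-w\rangle$ for $i=1,\ldots,m$; $\partial P_1,\partial P_2$ are subdifferentials of convex functions; $\mathcal{N}_C(x)$ is the normal cone of the convex set $C$ at $x\in C$; sums and differences of sets are Minkowski sums and differences. Algorithm ESQM$_{\rm e}$. Choose $x^{-1}=x^0\in C$, $\theta_0>0$, $d>0$ and $\{\beta_k\}\subseteq\left[0,\sqrt{\frac{L_g}{L_g+\ell_g}}\right)$ with $\bar\beta:=\sup_k\beta_k<\sqrt{\frac{L_g}{L_g+\ell_g}}$.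 For $k=0,1,2,\ldots$: (1) set $y^k=x^k+\beta_k(x^k-x^{k-1})$; (2) take any $\xi^k\in\partial P_2(x^k)$ and let $(x^{k+1},s^{k+1})$ be a minimizer over $(x,s)\in C\times\mathbb{R}_+$ of $P_1(x)-\langle\xi^k,x\rangle+\theta_k s+\frac{\theta_kL_g}{2}\|x-y^k\|^2$ subject to ${\rm lin}_{g_i}(x,y^k)\le s$ for $i=1,\ldots,m$; (3) if ${\rm lin}_{g_i}(x^{k+1},y^k)\le 0$ for all $i=1,\ldots,m$, set $\theta_{k+1}=\theta_k$; otherwise set $\theta_{k+1}=\theta_k+d$. Assumption A. For every $x\in C\cap\mathscr{F}$, the condition $RCQ(x)$ holds: there exists $y\in C$ such that $g_i(x)+\langle\nabla g_i(x),y-x\rangle<0$ for all $i=1,\ldots,m$. Moreover, for every $x\in C\setminus\mathscr{F}$ there do not exist $u_i$, $i\in I(x)$, such that $u_i\ge 0$ for all $i\in I(x)$, $\sum_{i\in I(x)}u_i=1$ and $\left\langle\sum_{i\in I(x)}u_i\nabla g_i(x),z-x\right\rangle\ge 0$ for all $z\in C$, where $I(x):=\{\iota\in\{1,\ldots,m\}:g_\iota(x)=\max_{i=1,\ldots,m}[g_i(x)]_+\}$. Eventual penalty parameter. Under Assumption A there exists $N_0\in\mathbb{N}$ such that $\theta_k=\theta_{N_0}$ for all $k\ge N_0$; this $\theta_{N_0}$ is the one used in the claim. Critical point. $x$ is a critical point of the problem if $x\in C$ and there exists $\lambda=(\lambda_1,\ldots,\lambda_m)\in\mathbb{R}_+^m$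 such that $g_i(x)\le 0$ and $\lambda_ig_i(x)=0$ for all $i=1,\ldots,m$, and $0\in\partial P_1(x)-\partial P_2(x)+\sum_{i=1}^m\lambda_i\nabla g_i(x)+\mathcal{N}_C(x)$. *)

theory Defs
  imports "HOL-Analysis.Analysis" "HOL-Library.Set_Algebras"
begin

text \<open>
  The constraint functions form a family \<open>g :: nat \<Rightarrow> 'a \<Rightarrow> real\<close>, of which only the members
  \<open>g 1, \<dots>, g m\<close> are ever used; \<open>g 0\<close> is irrelevant.
\<close>

definition subdifferential :: "('a::real_inner \<Rightarrow> real) \<Rightarrow> 'a \<Rightarrow> 'a set" where
  "subdifferential f x = {v. \<forall>y. f x + v \<bullet> (y - x) \<le> f y}"

definition normal_cone :: "'a::real_inner set \<Rightarrow> 'a \<Rightarrow> 'a set" where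
  "normal_cone C x = {v. x \<in> C \<and> (\<forall>z\<in>C. v \<bullet> (z - x) \<le> 0)}"

text \<open>
  The operation \<open>-\<close> on the type of sets is the set-theoretic difference, so the Minkowski
  difference needs a name of its own; Minkowski sums are \<open>+\<close> from \<open>Set_Algebras\<close>.
\<close>

definition minkowski_diff :: "'a::minus set \<Rightarrow> 'a set \<Rightarrow> 'a set" where
  "minkowski_diff A B = {a - b | a b. a \<in> A \<and> b \<in> B}"

definition gradient :: "('a::real_inner \<Rightarrow> real) \<Rightarrow> 'a \<Rightarrow> 'a" where
  "gradient f x = (THE v. GDERIV f x :> v)"

lemma gradient_eqI:
  assumes "GDERIV f x :> v"
  shows "gradient f x = v"
  unfolding gradient_def
proof (rule the_equality)
  fix w assume "GDERIV f x :> w"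
  then have "(\<lambda>h. h \<bullet> w) = (\<lambda>h. h \<bullet> v)"
    using assms has_derivative_unique unfolding gderiv_def by blast
  then show "w = v"
    by (metis vector_eq_ldot)
qed (rule assms)

definition lipschitz_gradient :: "real \<Rightarrow> ('a::real_inner \<Rightarrow> real) \<Rightarrow> bool" where
  "lipschitz_gradient L f \<longleftrightarrow>
     (\<forall>x. f differentiable (at x)) \<and> L-lipschitz_on UNIV (gradient f)"

definition lin :: "('a::real_inner \<Rightarrow> real) \<Rightarrow> 'a \<Rightarrow> 'a \<Rightarrow> real" where
  "lin f u w = f w + gradient f w \<bullet> (u - w)"

definition feasible_set :: "nat \<Rightarrow> (nat \<Rightarrow> 'a \<Rightarrow> real) \<Rightarrow> 'a set" where
  "feasible_set m g = {x. \<forall>i\<in>{1..m}. g i x \<le> 0}"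

definition RCQ :: "'a::real_inner set \<Rightarrow> nat \<Rightarrow> (nat \<Rightarrow> 'a \<Rightarrow> real) \<Rightarrow> 'a \<Rightarrow> bool" where
  "RCQ C m g x \<longleftrightarrow> (\<exists>y\<in>C. \<forall>i\<in>{1..m}. g i x + gradient (g i) x \<bullet> (y - x) < 0)"

definition max_violation_indices :: "nat \<Rightarrow> (nat \<Rightarrow> 'a \<Rightarrow> real) \<Rightarrow> 'a \<Rightarrow> nat set" where
  "max_violation_indices m g x =
     {\<iota>\<in>{1..m}. g \<iota> x = Max ((\<lambda>i. max (g i x) 0) ` {1..m})}"

definition assumption_A :: "'a::real_inner set \<Rightarrow> nat \<Rightarrow> (nat \<Rightarrow> 'a \<Rightarrow> real) \<Rightarrow> bool" where
  "assumption_A C m g \<longleftrightarrow>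
     (\<forall>x \<in> C \<inter> feasible_set m g. RCQ C m g x) \<and>
     (\<forall>x \<in> C - feasible_set m g.
        \<not> (\<exists>u :: nat \<Rightarrow> real.
             (\<forall>i\<in>max_violation_indices m g x. 0 \<le> u i) \<and>
             (\<Sum>i\<in>max_violation_indices m g x. u i) = 1 \<and>
             (\<forall>z\<in>C. 0 \<le> (\<Sum>i\<in>max_violation_indices m g x. u i *\<^sub>R gradient (g i) x) \<bullet> (z - x))))"

definition subproblem_objective ::
  "('a::real_inner \<Rightarrow> real) \<Rightarrow> real \<Rightarrow> real \<Rightarrow> 'a \<Rightarrow> 'a \<Rightarrow> 'a \<times> real \<Rightarrow> real" where
  "subproblem_objective P1 Lg \<theta> \<xi> y =
     (\<lambda>(x, s). P1 x - \<xi> \<bullet> x + \<theta> * s + \<theta> * Lg / 2 * (norm (x - y))\<^sup>2)"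

definition subproblem_feasible ::
  "'a::real_inner set \<Rightarrow> nat \<Rightarrow> (nat \<Rightarrow> 'a \<Rightarrow> real) \<Rightarrow> 'a \<Rightarrow> ('a \<times> real) set" where
  "subproblem_feasible C m g y =
     {(x, s). x \<in> C \<and> 0 \<le> s \<and> (\<forall>i\<in>{1..m}. lin (g i) x y \<le> s)}"

text \<open>
  A run of the algorithm, with starting point \<open>x 0\<close>. The conditional in the extrapolation step
  encodes the convention that the iterate preceding \<open>x 0\<close> is \<open>x 0\<close> itself. The value \<open>s 0\<close> is
  not used.
\<close>

definition ESQM_e_run ::
  "('a::real_inner \<Rightarrow> real) \<Rightarrow> ('a \<Rightarrow> real) \<Rightarrow> 'a set \<Rightarrow> nat \<Rightarrow> (nat \<Rightarrow> 'a \<Rightarrow> real) \<Rightarrow>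
   real \<Rightarrow> real \<Rightarrow> real \<Rightarrow> (nat \<Rightarrow> real) \<Rightarrow>
   (nat \<Rightarrow> 'a) \<Rightarrow> (nat \<Rightarrow> real) \<Rightarrow> (nat \<Rightarrow> 'a) \<Rightarrow> (nat \<Rightarrow> 'a) \<Rightarrow> (nat \<Rightarrow> real) \<Rightarrow> bool" where
  "ESQM_e_run P1 P2 C m g Lg lg d \<beta> x s y \<xi> \<theta> \<longleftrightarrow>
     x 0 \<in> C \<and> 0 < \<theta> 0 \<and> 0 < d \<and>
     (\<forall>k. \<beta> k \<in> {0..<sqrt (Lg / (Lg + lg))}) \<and>
     (SUP k. \<beta> k) < sqrt (Lg / (Lg + lg)) \<and>
     (\<forall>k. y k = x k + \<beta> k *\<^sub>R (x k - (if k = 0 then x 0 else x (k - 1)))) \<and>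
     (\<forall>k. \<xi> k \<in> subdifferential P2 (x k)) \<and>
     (\<forall>k. is_arg_min (subproblem_objective P1 Lg (\<theta> k) (\<xi> k) (y k))
                     (\<lambda>p. p \<in> subproblem_feasible C m g (y k))
                     (x (Suc k), s (Suc k))) \<and>
     (\<forall>k. \<theta> (Suc k) =
            (if \<forall>i\<in>{1..m}. lin (g i) (x (Suc k)) (y k) \<le> 0 then \<theta> k else \<theta> k + d))"

definition accumulation_point :: "(nat \<Rightarrow> 'a::topological_space) \<Rightarrow> 'a \<Rightarrow> bool" where
  "accumulation_point x a \<longleftrightarrow> (\<exists>r :: nat \<Rightarrow> nat. strict_mono r \<and> (x \<circ> r) \<longlonglongrightarrow> a)"

definition critical_point ::
  "('a::real_inner \<Rightarrow> real) \<Rightarrow> ('a \<Rightarrow> real) \<Rightarrow> 'a set \<Rightarrow> nat \<Rightarrow> (nat \<Rightarrow> 'a \<Rightarrow> real) \<Rightarrow> 'a \<Rightarrow> bool" where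
  "critical_point P1 P2 C m g x \<longleftrightarrow>
     x \<in> C \<and>
     (\<exists>lam :: nat \<Rightarrow> real.
        (\<forall>i\<in>{1..m}. 0 \<le> lam i \<and> g i x \<le> 0 \<and> lam i * g i x = 0) \<and>
        0 \<in> minkowski_diff (subdifferential P1 x) (subdifferential P2 x)
            + {\<Sum>i=1..m. lam i *\<^sub>R gradient (g i) x} + normal_cone C x)"

definition with_zero :: "(nat \<Rightarrow> 'a \<Rightarrow> real) \<Rightarrow> nat \<Rightarrow> 'a \<Rightarrow> real" where
  "with_zero g = g(0 := (\<lambda>_. 0))"

definition active_indices :: "nat \<Rightarrow> (nat \<Rightarrow> 'a \<Rightarrow> real) \<Rightarrow> 'a \<Rightarrow> nat set" where
  "active_indices m g x =
     {\<iota>\<in>{0..m}. with_zero g \<iota> x = Max ((\<lambda>i. with_zero g i x) ` {0..m})}"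

end

theory Submission
  imports Defs
begin

text \<open>
  Write \<open>v(x)\<close> for the constraint violation, the largest positive part of the \<open>g\<^sub>i(x)\<close>. Everything
  follows from one variational inequality for the subproblem, obtained by moving its minimiser
  slightly towards a competitor (\<open>subproblem_variational_inequality\<close>), used with three different
  competitors.

  With the previous iterate as competitor it gives a descent inequality (\<open>descent\<close>). After division
  by \<open>\<theta>\<^sub>k\<close>, with \<open>B\<close> a lower bound of \<open>P\<close> on \<open>C\<close>, this shows that
  \<open>(P(x\<^sub>k) - B) / \<theta>\<^sub>k + v(x\<^sub>k) + (Lg / 2) \<parallel>x\<^sub>k - x\<^sub>k\<^sub>-\<^sub>1\<parallel>\<^sup>2\<close> decreases by at least a fixed multiple of
  \<open>\<parallel>x\<^sub>k - x\<^sub>k\<^sub>-\<^sub>1\<parallel>\<^sup>2\<close>, whatever the penalties do; the bound on the extrapolation parameters is exactly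
  what makes that multiple positive. Hence the steps vanish (\<open>step_tendsto_0\<close>), and \<open>x\<^sub>k\<close>, \<open>x\<^sub>k\<^sub>+\<^sub>1\<close> and
  \<open>y\<^sub>k\<close> share their accumulation points.

  Assumption A ensures that from any point \<open>a\<close> of \<open>C\<close> all linearised constraints can be brought
  strictly below \<open>v(a)\<close> within \<open>C\<close> (\<open>decrease_direction\<close>). A point doing so, used as competitor and
  divided by \<open>\<theta>\<^sub>k\<close>, contradicts \<open>\<theta>\<^sub>k \<rightarrow> \<infinity>\<close>. Since \<open>\<theta>\<close> moves in steps of fixed size, it is eventually constant
  (\<open>penalty_eventually_constant\<close>).

  With constant penalty and a fixed competitor \<open>z\<close>, the inequality passes to the limit along a
  subsequence on which the subgradients of \<open>P2\<close> converge: the accumulation point minimises a convex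
  function penalised by a maximum of linear forms (\<open>accumulation_point_limits\<close>). The multipliers come
  from convex separation, which supplies a sum rule (\<open>convex_minimum_sandwich\<close>) and from it an
  alternative of Gordan type (\<open>linear_forms_alternative\<close>). The latter is also what converts
  the multiplier condition in Assumption A into a direction of decrease.
\<close>

section \<open>Minima of convex functions and multipliers\<close>

text \<open>
  A minimum of \<open>f + h\<close> over \<open>C\<close> says that the strict epigraph of \<open>f\<close> misses the hypograph of
  \<open>f x + h x - h\<close> over \<open>C\<close>. A hyperplane separating the two cannot be vertical, because \<open>f\<close> is
  finite everywhere, so it is the graph of an affine function whose slope \<open>w\<close> serves both sides.
  This is a sum rule for subdifferentials.
\<close>

lemma convex_minimum_sandwich:
  fixes f h :: "'a::euclidean_space \<Rightarrow> real"
  assumes f: "convex_on UNIV f" and C: "convex C" and h: "convex_on C h" and x: "x \<in> C"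
    and min: "\<And>z. z \<in> C \<Longrightarrow> f x + h x \<le> f z + h z"
  obtains w where "w \<in> subdifferential f x" "\<And>z. z \<in> C \<Longrightarrow> h x - w \<bullet> (z - x) \<le> h z"
proof -
  define U where "U = {p :: 'a \<times> real. f (fst p) < snd p}"
  define V where "V = {p :: 'a \<times> real. fst p \<in> C \<and> snd p \<le> f x + h x - h (fst p)}"
  have "convex U"
  proof (rule convexI)
    fix p q :: "'a \<times> real" and u v :: real
    assume pq: "p \<in> U" "q \<in> U" and uv: "0 \<le> u" "0 \<le> v" "u + v = 1"
    have "f (u *\<^sub>R fst p + v *\<^sub>R fst q) \<le> u * f (fst p) + v * f (fst q)"
      using f uv unfolding convex_on_def by auto
    also have "\<dots> < u * snd p + v * snd q"
    proof (cases "u = 0")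
      case True
      then show ?thesis using pq uv by (simp add: U_def)
    next
      case False
      have "u * f (fst p) < u * snd p" using False uv pq by (simp add: U_def)
      moreover have "v * f (fst q) \<le> v * snd q" using uv pq by (simp add: U_def mult_left_mono)
      ultimately show ?thesis by linarith
    qed
    finally show "u *\<^sub>R p + v *\<^sub>R q \<in> U" by (simp add: U_def)
  qed
  moreover have "convex V"
  proof (rule convexI)
    fix p q :: "'a \<times> real" and u v :: real
    assume pq: "p \<in> V" "q \<in> V" and uv: "0 \<le> u" "0 \<le> v" "u + v = 1"
    have "h (u *\<^sub>R fst p + v *\<^sub>R fst q) \<le> u * h (fst p) + v * h (fst q)"
      using h uv pq unfolding convex_on_def V_def by auto
    moreover have "u * snd p + v * snd q \<le> u * (f x + h x - h (fst p)) + v * (f x + h x - h (fst q))"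
      using uv pq unfolding V_def by (intro add_mono mult_left_mono) auto
    moreover have "\<dots> = (u + v) * (f x + h x) - (u * h (fst p) + v * h (fst q))"
      by (simp add: algebra_simps)
    moreover have "u *\<^sub>R fst p + v *\<^sub>R fst q \<in> C"
      using C pq uv unfolding V_def by (auto intro: convexD)
    ultimately show "u *\<^sub>R p + v *\<^sub>R q \<in> V" using uv by (simp add: V_def)
  qed
  moreover have "(x, f x + 1) \<in> U" and xV: "(x, f x) \<in> V" using x by (auto simp: U_def V_def)
  moreover have "U \<inter> V = {}" using min by (force simp: U_def V_def)
  ultimately obtain a :: "'a \<times> real" and b where a0: "a \<noteq> 0"
    and aU: "\<And>p. p \<in> U \<Longrightarrow> a \<bullet> p \<le> b" and aV: "\<And>p. p \<in> V \<Longrightarrow> b \<le> a \<bullet> p"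
    using separating_hyperplane_sets[of U V] by (metis empty_iff)
  obtain p q where apq: "a = (p, q)" by (cases a)
  have low: "p \<bullet> z + q * r \<le> b" if "f z < r" for z r
    using aU[of "(z, r)"] that by (simp add: U_def apq)
  have top: "b \<le> p \<bullet> x + q * f x"
    using aV[OF xV] by (simp add: apq)
  \<comment> \<open>The separating hyperplane is not vertical.\<close>
  have "q < 0"
  proof (rule ccontr)
    assume "\<not> q < 0"
    have "q = 0"
    proof (rule ccontr)
      assume "q \<noteq> 0"
      with \<open>\<not> q < 0\<close> have "q * 1 > 0" by simp
      moreover have "q * (f x + 1) \<le> q * f x" using low[of x "f x + 1"] top by simp
      ultimately show False by (simp add: algebra_simps)
    qed
    then have "p \<noteq> 0" using a0 apq by (simp add: zero_prod_def)
    have "p \<bullet> (x + p) \<le> p \<bullet> x"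
      using low[of "x + p" "f (x + p) + 1"] top \<open>q = 0\<close> by simp
    then show False using \<open>p \<noteq> 0\<close> by (simp add: inner_add_right flip: not_less)
  qed
  have epi: "p \<bullet> z + q * f z \<le> b" for z
  proof (rule field_le_epsilon)
    fix e :: real assume "0 < e"
    have "p \<bullet> z + q * (f z + e / - q) \<le> b" using low \<open>q < 0\<close> \<open>0 < e\<close> by (simp add: divide_pos_neg)
    moreover have "q * (f z + e / - q) = q * f z - e" using \<open>q < 0\<close> by (simp add: right_diff_distrib)
    ultimately show "p \<bullet> z + q * f z \<le> b + e" by simp
  qed
  define w where "w = (1 / - q) *\<^sub>R p"
  have pw: "p = (- q) *\<^sub>R w" using \<open>q < 0\<close> by (simp add: w_def)
  show thesis
  proof
    show "w \<in> subdifferential f x" unfolding subdifferential_def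
    proof safe
      fix z
      have "(- q) * (w \<bullet> (z - x)) \<le> (- q) * (f z - f x)"
        using epi[of z] top by (simp add: pw inner_diff_right algebra_simps)
      then show "f x + w \<bullet> (z - x) \<le> f z" using \<open>q < 0\<close> by simp
    qed
  next
    fix z assume "z \<in> C"
    then have "b \<le> p \<bullet> z + q * (f x + h x - h z)"
      using aV[of "(z, f x + h x - h z)"] by (simp add: V_def apq)
    then have "(- q) * (h x - h z) \<le> (- q) * (w \<bullet> (z - x))"
      using epi[of x] by (simp add: pw inner_diff_right algebra_simps)
    then show "h x - w \<bullet> (z - x) \<le> h z" using \<open>q < 0\<close> by simp
  qed
qed

lemma convex_on_Max_linear:
  fixes u :: "'i \<Rightarrow> 'a::real_inner"
  assumes "finite A" "A \<noteq> {}"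
  shows "convex_on UNIV (\<lambda>z. Max ((\<lambda>i. u i \<bullet> (z - x)) ` A))"
proof (rule convex_onI)
  fix t :: real and a b :: 'a assume t: "0 < t" "t < 1"
  show "Max ((\<lambda>i. u i \<bullet> (((1 - t) *\<^sub>R a + t *\<^sub>R b) - x)) ` A)
      \<le> (1 - t) * Max ((\<lambda>i. u i \<bullet> (a - x)) ` A) + t * Max ((\<lambda>i. u i \<bullet> (b - x)) ` A)"
  proof (rule Max.boundedI)
    fix r assume "r \<in> (\<lambda>i. u i \<bullet> (((1 - t) *\<^sub>R a + t *\<^sub>R b) - x)) ` A"
    then obtain i where i: "i \<in> A" and r: "r = u i \<bullet> (((1 - t) *\<^sub>R a + t *\<^sub>R b) - x)" by auto
    have "r = (1 - t) * (u i \<bullet> (a - x)) + t * (u i \<bullet> (b - x))"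
      unfolding r by (simp add: inner_diff_right inner_add_right algebra_simps)
    also have "\<dots> \<le> (1 - t) * Max ((\<lambda>i. u i \<bullet> (a - x)) ` A) + t * Max ((\<lambda>i. u i \<bullet> (b - x)) ` A)"
      using assms i t by (intro add_mono mult_left_mono Max_ge) auto
    finally show "r \<le> \<dots>" .
  qed (use assms in auto)
qed auto

text \<open>
  Coefficients indexed by \<open>A\<close> rather than by the points \<open>u i\<close>, which may coincide for different \<open>i\<close>.
\<close>

lemma convex_hull_indexed_image:
  fixes u :: "'i \<Rightarrow> 'a::real_vector"
  assumes "finite A" "w \<in> convex hull (u ` A)"
  shows "\<exists>c :: 'i \<Rightarrow> real. (\<forall>i\<in>A. 0 \<le> c i) \<and> sum c A = 1 \<and> w = (\<Sum>i\<in>A. c i *\<^sub>R u i)"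
proof -
  let ?S = "{\<Sum>i\<in>A. c i *\<^sub>R u i | c :: 'i \<Rightarrow> real. (\<forall>i\<in>A. 0 \<le> c i) \<and> sum c A = 1}"
  have "convex hull (u ` A) \<subseteq> ?S"
  proof (rule hull_minimal)
    show "u ` A \<subseteq> ?S"
    proof
      fix v assume "v \<in> u ` A"
      then obtain j where j: "j \<in> A" "v = u j" by auto
      let ?c = "\<lambda>i. if i = j then 1 else 0 :: real"
      have "v = (\<Sum>i\<in>A. ?c i *\<^sub>R u i)" "sum ?c A = 1"
        using j assms(1) by (simp_all add: if_distrib[of "\<lambda>r. r *\<^sub>R _"] cong: if_cong)
      then show "v \<in> ?S" by (intro CollectI exI[of _ ?c]) auto
    qed
    show "convex ?S"
    proof (rule convexI)
      fix p q and s t :: real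
      assume "p \<in> ?S" "q \<in> ?S" and st: "0 \<le> s" "0 \<le> t" "s + t = 1"
      then obtain c e :: "'i \<Rightarrow> real" where c: "\<forall>i\<in>A. 0 \<le> c i" "sum c A = 1" "p = (\<Sum>i\<in>A. c i *\<^sub>R u i)"
        and e: "\<forall>i\<in>A. 0 \<le> e i" "sum e A = 1" "q = (\<Sum>i\<in>A. e i *\<^sub>R u i)" by auto
      have "s *\<^sub>R p + t *\<^sub>R q = (\<Sum>i\<in>A. (s * c i + t * e i) *\<^sub>R u i)"
        by (simp add: c e scaleR_sum_right scaleR_left_distrib sum.distrib)
      moreover have "(\<Sum>i\<in>A. s * c i + t * e i) = 1"
        using c e st by (simp add: sum.distrib sum_distrib_left[symmetric])
      moreover have "\<forall>i\<in>A. 0 \<le> s * c i + t * e i" using c e st by simp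
      ultimately show "s *\<^sub>R p + t *\<^sub>R q \<in> ?S"
        by (intro CollectI exI[of _ "\<lambda>i. s * c i + t * e i"]) auto
    qed
  qed
  then show ?thesis using assms(2) by blast
qed

text \<open>
  Gordan's alternative relative to a convex set: either some point of \<open>C\<close> makes all the linear
  forms negative at once, or a convex combination of them is nonnegative on \<open>C\<close>. If no such point
  exists, \<open>x\<close> minimises the maximum of the forms over \<open>C\<close>, so the sandwich lemma with \<open>h = 0\<close> yields a
  subgradient of that maximum which is nonnegative on \<open>C\<close>; and the subgradients of a maximum of
  linear forms at its apex lie in the convex hull of the forms.
\<close>

lemma linear_forms_alternative:
  fixes u :: "'i \<Rightarrow> 'a::euclidean_space"
  assumes A: "finite A" "A \<noteq> {}" and C: "convex C" "x \<in> C"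
    and nodescent: "\<And>z. z \<in> C \<Longrightarrow> \<exists>i\<in>A. 0 \<le> u i \<bullet> (z - x)"
  shows "\<exists>c :: 'i \<Rightarrow> real. (\<forall>i\<in>A. 0 \<le> c i) \<and> sum c A = 1 \<and>
    (\<forall>z\<in>C. 0 \<le> (\<Sum>i\<in>A. c i *\<^sub>R u i) \<bullet> (z - x))"
proof -
  define f where "f z = Max ((\<lambda>i. u i \<bullet> (z - x)) ` A)" for z
  have "convex_on UNIV f" unfolding f_def by (rule convex_on_Max_linear[OF A])
  moreover have f0: "f x = 0" using A by (simp add: f_def image_constant_conv)
  moreover have "0 \<le> f z" if "z \<in> C" for z
    unfolding f_def using nodescent[OF that] A by (subst Max_ge_iff) auto
  moreover have "convex_on C (\<lambda>z. 0 :: real)" using C by (simp add: convex_on_const)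
  ultimately obtain w where w: "w \<in> subdifferential f x"
    and "\<And>z. z \<in> C \<Longrightarrow> 0 - w \<bullet> (z - x) \<le> 0"
    using convex_minimum_sandwich[of f C "\<lambda>_. 0" x] C by auto
  then have wC: "\<And>z. z \<in> C \<Longrightarrow> 0 \<le> w \<bullet> (z - x)" by simp
  have "w \<in> convex hull (u ` A)"
  proof (rule ccontr)
    assume "w \<notin> convex hull (u ` A)"
    moreover have "closed (convex hull (u ` A))"
      using A by (simp add: compact_imp_closed finite_imp_compact_convex_hull)
    ultimately obtain a b where ab: "a \<bullet> w < b" "\<And>v. v \<in> convex hull (u ` A) \<Longrightarrow> b < a \<bullet> v"
      using separating_hyperplane_closed_point[of "convex hull (u ` A)" w] by auto
    \<comment> \<open>A direction separating \<open>w\<close> from the hull violates the subgradient inequality of \<open>w\<close>.\<close>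
    have "f (x - a) < w \<bullet> (- a)" unfolding f_def
    proof (subst Max_less_iff)
      show "\<forall>r\<in>(\<lambda>i. u i \<bullet> (x - a - x)) ` A. r < w \<bullet> - a"
        using ab hull_inc[of _ "u ` A" convex] by (fastforce simp: inner_commute)
    qed (use A in auto)
    moreover have "w \<bullet> (- a) \<le> f (x - a)"
      using w f0 by (auto simp: subdifferential_def dest!: spec[of _ "x - a"])
    ultimately show False by simp
  qed
  then show ?thesis using convex_hull_indexed_image[OF A(1)] wC by metis
qed

text \<open>
  First-order conditions for \<open>f - \<xi> + \<theta> max\<^sub>i v\<^sub>i\<close> at a minimum over \<open>C\<close>. The sandwich lemma linearises
  \<open>f\<close>; what remains is a maximum of linear forms that is nonnegative on \<open>C\<close>, and the alternative
  above turns the maximum into a convex combination.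
\<close>

lemma penalised_minimum_multipliers:
  fixes f :: "'a::euclidean_space \<Rightarrow> real" and v :: "'i \<Rightarrow> 'a"
  assumes f: "convex_on UNIV f" and C: "convex C" "x \<in> C" and A: "finite A" "A \<noteq> {}" and \<theta>: "0 \<le> \<theta>"
    and min: "\<And>z. z \<in> C \<Longrightarrow> 0 \<le> f z - f x - \<xi> \<bullet> (z - x) + \<theta> * Max ((\<lambda>i. v i \<bullet> (z - x)) ` A)"
  shows "\<exists>w\<in>subdifferential f x. \<exists>c :: 'i \<Rightarrow> real. (\<forall>i\<in>A. 0 \<le> c i) \<and> sum c A = 1 \<and>
    - (w - \<xi> + \<theta> *\<^sub>R (\<Sum>i\<in>A. c i *\<^sub>R v i)) \<in> normal_cone C x"
proof -
  define H where "H z = Max ((\<lambda>i. v i \<bullet> (z - x)) ` A)" for z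
  define h where "h z = \<theta> * H z - \<xi> \<bullet> (z - x)" for z
  have "convex_on C H" unfolding H_def
    using convex_on_Max_linear[OF A] convex_on_subset C by blast
  then have "convex_on C (\<lambda>z. \<theta> * H z)" using \<theta> by (rule convex_on_cmul[rotated])
  moreover have "convex_on C (\<lambda>z. - (\<xi> \<bullet> (z - x)))"
    using C by (auto intro!: convex_onI simp: inner_diff_right inner_add_right algebra_simps)
  ultimately have "convex_on C h" unfolding h_def using convex_on_add by fastforce
  moreover have "H x = 0" using A by (simp add: H_def image_constant_conv)
  then have hx: "h x = 0" by (simp add: h_def)
  moreover have "f x + h x \<le> f z + h z" if "z \<in> C" for z
    using min[OF that] by (simp add: hx) (simp add: h_def H_def)
  ultimately obtain w where w: "w \<in> subdifferential f x"
    and "\<And>z. z \<in> C \<Longrightarrow> h x - w \<bullet> (z - x) \<le> h z"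
    using convex_minimum_sandwich[OF f C(1) _ C(2), of h] by metis
  then have wC: "\<And>z. z \<in> C \<Longrightarrow> - (w \<bullet> (z - x)) \<le> h z" by (simp add: hx)
  have "\<exists>i\<in>A. 0 \<le> (w - \<xi> + \<theta> *\<^sub>R v i) \<bullet> (z - x)" if "z \<in> C" for z
  proof -
    have "Max ((\<lambda>i. v i \<bullet> (z - x)) ` A) \<in> (\<lambda>i. v i \<bullet> (z - x)) ` A" using A by simp
    then obtain i where "i \<in> A" "H z = v i \<bullet> (z - x)" unfolding H_def by blast
    then show ?thesis using wC[OF that] by (auto simp: h_def inner_add_left inner_diff_left intro!: bexI[of _ i])
  qed
  then obtain c where c: "\<forall>i\<in>A. 0 \<le> c i" "sum c A = 1"
    "\<forall>z\<in>C. 0 \<le> (\<Sum>i\<in>A. c i *\<^sub>R (w - \<xi> + \<theta> *\<^sub>R v i)) \<bullet> (z - x)"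
    using linear_forms_alternative[OF A C, of "\<lambda>i. w - \<xi> + \<theta> *\<^sub>R v i"] by metis
  have "(\<Sum>i\<in>A. c i *\<^sub>R (w - \<xi> + \<theta> *\<^sub>R v i))
      = (\<Sum>i\<in>A. c i *\<^sub>R (w - \<xi>)) + \<theta> *\<^sub>R (\<Sum>i\<in>A. c i *\<^sub>R v i)"
    by (simp only: scaleR_right_distrib sum.distrib scaleR_sum_right scaleR_left_commute)
  also have "(\<Sum>i\<in>A. c i *\<^sub>R (w - \<xi>)) = w - \<xi>" using c(2) by (simp flip: scaleR_sum_left)
  finally have "- (w - \<xi> + \<theta> *\<^sub>R (\<Sum>i\<in>A. c i *\<^sub>R v i)) \<in> normal_cone C x"
    using C(2) c(3) by (fastforce simp: normal_cone_def inner_add_left inner_diff_left)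
  then show ?thesis using w c(1,2) by blast
qed

section \<open>Gradients and linearisations\<close>

lemma GDERIV_gradient:
  fixes f :: "'a::euclidean_space \<Rightarrow> real"
  assumes "f differentiable (at x)"
  shows "GDERIV f x :> gradient f x"
proof -
  obtain D where D: "(f has_derivative D) (at x)" using assms by (auto simp: differentiable_def)
  have "linear D" using D by (rule has_derivative_linear)
  have "D h = h \<bullet> (\<Sum>b\<in>Basis. D b *\<^sub>R b)" for h
  proof -
    have "D h = D (\<Sum>b\<in>Basis. (h \<bullet> b) *\<^sub>R b)" by (simp add: euclidean_representation)
    also have "\<dots> = (\<Sum>b\<in>Basis. (h \<bullet> b) * D b)"
      using \<open>linear D\<close> by (simp add: linear_sum linear_cmul)
    finally show ?thesis by (simp add: inner_sum_right mult.commute)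
  qed
  then have "D = (\<lambda>h. h \<bullet> (\<Sum>b\<in>Basis. D b *\<^sub>R b))" by blast
  then have "GDERIV f x :> (\<Sum>b\<in>Basis. D b *\<^sub>R b)" using D unfolding gderiv_def by simp
  then show ?thesis using gradient_eqI by metis
qed

lemma has_field_derivative_along_segment:
  fixes f :: "'a::euclidean_space \<Rightarrow> real"
  assumes "\<And>x. f differentiable (at x)"
  shows "((\<lambda>t. f (y + t *\<^sub>R v)) has_field_derivative gradient f (y + t *\<^sub>R v) \<bullet> v) (at t)"
proof -
  have "(f has_derivative (\<lambda>h. h \<bullet> gradient f (y + t *\<^sub>R v))) (at (y + t *\<^sub>R v))"
    using GDERIV_gradient[OF assms] by (simp add: gderiv_def)
  moreover have "((\<lambda>t. y + t *\<^sub>R v) has_derivative (\<lambda>h. h *\<^sub>R v)) (at t)"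
    by (auto intro!: derivative_eq_intros)
  ultimately have "((\<lambda>t. f (y + t *\<^sub>R v)) has_derivative (\<lambda>h. (h *\<^sub>R v) \<bullet> gradient f (y + t *\<^sub>R v))) (at t)"
    by (rule has_derivative_compose[rotated])
  then show ?thesis
    by (simp add: has_field_derivative_def inner_commute mult_commute_abs)
qed

text \<open>
  The descent lemma: along the segment from \<open>y\<close> to \<open>x\<close>, the derivative of \<open>f\<close> exceeds its initial
  value by at most \<open>K t \<parallel>x - y\<parallel>\<^sup>2\<close>.
\<close>

lemma lin_lipschitz_upper:
  fixes f :: "'a::euclidean_space \<Rightarrow> real"
  assumes "lipschitz_gradient K f"
  shows "f x \<le> lin f x y + K / 2 * (norm (x - y))\<^sup>2"
proof -
  have diff: "\<And>z. f differentiable (at z)" and lip: "K-lipschitz_on UNIV (gradient f)"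
    using assms by (auto simp: lipschitz_gradient_def)
  let ?v = "x - y"
  define \<phi> where "\<phi> t = f (y + t *\<^sub>R ?v) - t * (gradient f y \<bullet> ?v) - K / 2 * t\<^sup>2 * (norm ?v)\<^sup>2" for t
  have "\<phi> 1 \<le> \<phi> 0"
  proof (rule DERIV_nonpos_imp_nonincreasing[of 0 1 \<phi>])
    fix t :: real assume t: "0 \<le> t" "t \<le> 1"
    let ?D = "(gradient f (y + t *\<^sub>R ?v) - gradient f y) \<bullet> ?v - K * t * (norm ?v)\<^sup>2"
    have "(\<phi> has_field_derivative ?D) (at t)"
      unfolding \<phi>_def
      by (rule derivative_eq_intros has_field_derivative_along_segment[OF diff] refl)+
        (simp add: inner_diff_left algebra_simps)
    moreover have "?D \<le> 0"
    proof -
      have "norm (gradient f (y + t *\<^sub>R ?v) - gradient f y) \<le> K * (t * norm ?v)"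
        using lipschitz_onD[OF lip, of "y + t *\<^sub>R ?v" y] t by (simp add: dist_norm)
      then have "(gradient f (y + t *\<^sub>R ?v) - gradient f y) \<bullet> ?v \<le> K * (t * norm ?v) * norm ?v"
        using norm_cauchy_schwarz[of "gradient f (y + t *\<^sub>R ?v) - gradient f y" ?v]
        by (meson mult_right_mono norm_ge_zero order_trans)
      then show ?thesis by (simp add: power2_eq_square mult.assoc)
    qed
    ultimately show "\<exists>D. (\<phi> has_field_derivative D) (at t) \<and> D \<le> 0" by blast
  qed simp
  then show ?thesis by (simp add: \<phi>_def lin_def)
qed

lemma lin_convex_lower:
  fixes f :: "'a::euclidean_space \<Rightarrow> real"
  assumes "convex_on UNIV f" "\<And>x. f differentiable (at x)"
  shows "lin f x y \<le> f x"
proof -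
  let ?\<phi> = "\<lambda>t. f (y + t *\<^sub>R (x - y))"
  have "convex_on UNIV ?\<phi>"
  proof (rule convex_onI)
    fix t a b :: real assume t: "0 < t" "t < 1"
    have "y + ((1 - t) *\<^sub>R a + t *\<^sub>R b) *\<^sub>R (x - y)
        = (1 - t) *\<^sub>R (y + a *\<^sub>R (x - y)) + t *\<^sub>R (y + b *\<^sub>R (x - y))"
      by (simp add: algebra_simps)
    then show "f (y + ((1 - t) *\<^sub>R a + t *\<^sub>R b) *\<^sub>R (x - y))
       \<le> (1 - t) * f (y + a *\<^sub>R (x - y)) + t * f (y + b *\<^sub>R (x - y))"
      using convex_onD[OF assms(1), of t] t by simp
  qed simp
  moreover have "(?\<phi> has_field_derivative gradient f (y + 0 *\<^sub>R (x - y)) \<bullet> (x - y)) (at 0)"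
    by (rule has_field_derivative_along_segment[OF assms(2)])
  ultimately have "?\<phi> 1 - ?\<phi> 0 \<ge> gradient f (y + 0 *\<^sub>R (x - y)) \<bullet> (x - y) * (1 - 0)"
    by (intro convex_on_imp_above_tangent[of UNIV]) auto
  then show ?thesis by (simp add: lin_def)
qed

lemma lin_diff:
  fixes f1 f2 :: "'a::euclidean_space \<Rightarrow> real"
  assumes "f1 differentiable (at y)" "f2 differentiable (at y)"
  shows "lin (\<lambda>z. f1 z - f2 z) x y = lin f1 x y - lin f2 x y"
proof -
  have "GDERIV (\<lambda>z. f1 z - f2 z) y :> gradient f1 y - gradient f2 y"
    using assms GDERIV_diff GDERIV_gradient by blast
  then have "gradient (\<lambda>z. f1 z - f2 z) y = gradient f1 y - gradient f2 y" by (rule gradient_eqI)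
  then show ?thesis by (simp add: lin_def inner_diff_left)
qed

lemma lin_convex_combination:
  "lin f ((1 - t) *\<^sub>R a + t *\<^sub>R b) y = (1 - t) * lin f a y + t * lin f b y"
proof -
  have "(1 - t) *\<^sub>R a + t *\<^sub>R b - y = (1 - t) *\<^sub>R (a - y) + t *\<^sub>R (b - y)" by (simp add: algebra_simps)
  then show ?thesis by (simp add: lin_def inner_add_right) (simp add: algebra_simps)
qed

text \<open>
  Linearisations are jointly continuous in the argument and the base point, which lets the
  constraints of the subproblems pass to the limit.
\<close>

lemma tendsto_lin:
  fixes f :: "'a::euclidean_space \<Rightarrow> real"
  assumes "lipschitz_gradient K f" "(u \<longlongrightarrow> u0) F" "(w \<longlongrightarrow> w0) F"
  shows "((\<lambda>k. lin f (u k) (w k)) \<longlongrightarrow> lin f u0 w0) F"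
proof -
  have "isCont f w0" using assms(1) by (simp add: lipschitz_gradient_def differentiable_imp_continuous_within)
  moreover have "isCont (gradient f) w0"
    using assms(1) lipschitz_on_continuous_on[of K UNIV "gradient f"]
    by (simp add: lipschitz_gradient_def continuous_on_eq_continuous_at)
  ultimately have "((\<lambda>k. f (w k)) \<longlongrightarrow> f w0) F" "((\<lambda>k. gradient f (w k)) \<longlongrightarrow> gradient f w0) F"
    using assms(3) by (auto intro: isCont_tendsto_compose)
  then show ?thesis unfolding lin_def using assms(2,3) by (intro tendsto_intros)
qed

section \<open>Subgradients of finite convex functions\<close>

text \<open>
  Testing a subgradient \<open>v\<close> at \<open>x\<close> against the point \<open>x + v / \<parallel>v\<parallel>\<close> bounds \<open>\<parallel>v\<parallel>\<close> by the oscillation of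
  \<open>f\<close> on the unit neighbourhood of the compact set.
\<close>

lemma bounded_subgradients:
  fixes f :: "'a::euclidean_space \<Rightarrow> real"
  assumes f: "convex_on UNIV f" and S: "compact S"
  shows "bounded (\<Union>x\<in>S. subdifferential f x)"
proof -
  have cont: "continuous_on UNIV f" using f by (intro convex_on_continuous) auto
  have "compact {x + h | x h. x \<in> S \<and> h \<in> cball 0 1}" using S by (intro compact_sums) auto
  then have "bounded (f ` {x + h | x h. x \<in> S \<and> h \<in> cball 0 1})"
    by (intro compact_imp_bounded compact_continuous_image continuous_on_subset[OF cont]) auto
  then obtain B where bB: "\<forall>r\<in>f ` {x + h | x h. x \<in> S \<and> h \<in> cball 0 1}. norm r \<le> B"
    unfolding bounded_iff by blast
  have B: "\<bar>f (x + h)\<bar> \<le> B" if "x \<in> S" "norm h \<le> 1" for x h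
  proof -
    have "h \<in> cball 0 1" using that by simp
    then have "f (x + h) \<in> f ` {x + h | x h. x \<in> S \<and> h \<in> cball 0 1}"
      using that(1) by blast
    then show ?thesis using bspec[OF bB] by (simp only: real_norm_def)
  qed
  have "norm v \<le> 2 * B" if "x \<in> S" "v \<in> subdifferential f x" for x v
  proof -
    have "f x + v \<bullet> ((x + sgn v) - x) \<le> f (x + sgn v)"
      using that(2) unfolding subdifferential_def by blast
    moreover have "v \<bullet> sgn v = norm v"
      by (cases "v = 0") (simp_all add: sgn_div_norm dot_square_norm power2_eq_square)
    moreover have "norm (sgn v) \<le> 1" by (simp add: norm_sgn)
    ultimately show ?thesis using B[OF that(1), of 0] B[OF that(1), of "sgn v"] by simp
  qed
  then show ?thesis unfolding bounded_iff by blast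
qed

lemma subdifferential_closed_graph:
  fixes f :: "'a::euclidean_space \<Rightarrow> real"
  assumes f: "convex_on UNIV f" and "x \<longlonglongrightarrow> a" "v \<longlonglongrightarrow> b"
    and v: "\<And>k. v k \<in> subdifferential f (x k)"
  shows "b \<in> subdifferential f a"
  unfolding subdifferential_def
proof safe
  fix z
  have "continuous_on UNIV f" using f by (intro convex_on_continuous) auto
  then have "isCont f a" by (simp add: continuous_on_eq_continuous_at)
  then have "(\<lambda>k. f (x k)) \<longlonglongrightarrow> f a" using assms(2) by (rule isCont_tendsto_compose)
  then have "(\<lambda>k. f (x k) + v k \<bullet> (z - x k)) \<longlonglongrightarrow> f a + b \<bullet> (z - a)"
    using assms(2,3) by (intro tendsto_intros)
  moreover have "f (x k) + v k \<bullet> (z - x k) \<le> f z" for k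
    using v by (auto simp: subdifferential_def)
  ultimately show "f a + b \<bullet> (z - a) \<le> f z" using LIMSEQ_le_const2 by blast
qed

section \<open>Optimality in the penalised subproblem\<close>

text \<open>
  Comparing the minimiser with \<open>(1 - t) (x, s) + t (z, \<tau>)\<close> and letting \<open>t\<close> tend to \<open>0\<close> removes the
  quadratic error term. The competitor \<open>(z, \<tau>)\<close> itself may be infeasible through \<open>\<tau> < 0\<close>: if
  \<open>s > 0\<close> the short segments still satisfy the sign constraint. Such negative \<open>\<tau>\<close> express strict
  feasibility, and with them the inequality detects that a positive \<open>s\<close> is too large.
\<close>

lemma subproblem_variational_inequality:
  fixes P1 :: "'a::euclidean_space \<Rightarrow> real"
  assumes P1: "convex_on UNIV P1" and C: "convex C"
    and min: "is_arg_min (subproblem_objective P1 Lg \<theta> \<xi> y) (\<lambda>p. p \<in> subproblem_feasible C m g y) (x, s)"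
    and z: "z \<in> C" "\<And>i. i \<in> {1..m} \<Longrightarrow> lin (g i) z y \<le> \<tau>" and \<tau>: "0 \<le> \<tau> \<or> 0 < s"
  shows "0 \<le> P1 z - P1 x - \<xi> \<bullet> (z - x) + \<theta> * (\<tau> - s) + \<theta> * Lg * ((x - y) \<bullet> (z - x))"
proof -
  define I J N where "I = (x - y) \<bullet> (z - x)" and "J = \<xi> \<bullet> (z - x)" and "N = (norm (z - x))\<^sup>2"
  let ?D = "P1 z - P1 x - J + \<theta> * (\<tau> - s) + \<theta> * Lg * I"
  let ?F = "subproblem_objective P1 Lg \<theta> \<xi> y"
  have x: "x \<in> C" "0 \<le> s" "\<And>i. i \<in> {1..m} \<Longrightarrow> lin (g i) x y \<le> s"
    and opt: "\<And>u r. u \<in> C \<Longrightarrow> 0 \<le> r \<Longrightarrow> (\<And>i. i \<in> {1..m} \<Longrightarrow> lin (g i) u y \<le> r) \<Longrightarrow> ?F (x, s) \<le> ?F (u, r)"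
    using min by (auto simp: is_arg_min_linorder subproblem_feasible_def)
  \<comment> \<open>Up to this step length the slack component stays nonnegative.\<close>
  define t0 where "t0 = (if 0 \<le> \<tau> then 1 else s / (s - \<tau>))"
  have t0: "0 < t0" "t0 \<le> 1" using \<tau> x(2) by (auto simp: t0_def field_simps)
  let ?K = "\<theta> * Lg / 2 * N"
  have main: "0 \<le> ?D + t * ?K" if t: "0 < t" "t \<le> t0" for t
  proof -
    let ?u = "(1 - t) *\<^sub>R x + t *\<^sub>R z" and ?r = "(1 - t) * s + t * \<tau>"
    have t1: "t \<le> 1" using t t0 by simp
    have "?u \<in> C" using C x z t t1 by (intro convexD) auto
    moreover have "0 \<le> ?r"
    proof (cases "0 \<le> \<tau>")
      case False
      then have "t * (s - \<tau>) \<le> s" using t x(2) by (simp add: t0_def field_simps)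
      then show ?thesis by (simp add: algebra_simps)
    qed (use x t t1 in auto)
    moreover have "lin (g i) ?u y \<le> ?r" if "i \<in> {1..m}" for i
      unfolding lin_convex_combination using x z that t t1 by (intro add_mono mult_left_mono) auto
    ultimately have "?F (x, s) \<le> ?F (?u, ?r)" by (rule opt)
    moreover have "P1 ?u \<le> (1 - t) * P1 x + t * P1 z"
      using convex_onD[OF P1, of t] t t1 by simp
    moreover have "?F (?u, ?r) - ?F (x, s)
      = P1 ?u - P1 x - t * J + t * (\<theta> * (\<tau> - s)) + \<theta> * Lg / 2 * (2 * t * I + t\<^sup>2 * N)"
    proof -
      have expand: "(norm (a + t *\<^sub>R b))\<^sup>2 = (norm a)\<^sup>2 + 2 * t * (a \<bullet> b) + t\<^sup>2 * (norm b)\<^sup>2" for a b :: 'a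
        unfolding power2_norm_eq_inner
        by (simp add: inner_add_left inner_add_right inner_commute[of b a] power2_eq_square)
          (simp add: algebra_simps)
      have "?u - y = (x - y) + t *\<^sub>R (z - x)" by (simp add: algebra_simps)
      then have "(norm (?u - y))\<^sup>2 = (norm (x - y))\<^sup>2 + (2 * t * I + t\<^sup>2 * N)"
        by (simp only: expand I_def N_def add.assoc)
      moreover have "\<xi> \<bullet> ?u = \<xi> \<bullet> x + t * J"
        by (simp add: J_def inner_add_right inner_diff_right algebra_simps)
      ultimately show ?thesis
        by (simp only: subproblem_objective_def prod.case distrib_left right_diff_distrib left_diff_distrib)
          simp
    qed
    ultimately have "0 \<le> t * (?D + t * ?K)"
      by (simp add: algebra_simps power2_eq_square)
    then show ?thesis using t by (simp add: zero_le_mult_iff)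
  qed
  have "((\<lambda>t. ?D + t * ?K) \<longlongrightarrow> ?D + 0 * ?K) (at_right 0)" by (intro tendsto_intros)
  moreover have "eventually (\<lambda>t. 0 \<le> ?D + t * ?K) (at_right 0)"
    unfolding eventually_at_right_field using main t0 by (intro exI[of _ t0]) auto
  ultimately have "0 \<le> ?D + 0 * ?K" by (intro tendsto_lowerbound[of _ _ "at_right 0"]) auto
  then show ?thesis by (simp add: I_def J_def)
qed

section \<open>The constraint violation\<close>

definition violation :: "nat \<Rightarrow> (nat \<Rightarrow> 'a \<Rightarrow> real) \<Rightarrow> 'a \<Rightarrow> real" where
  "violation m g x = Max ((\<lambda>i. max (g i x) 0) ` {1..m})"

lemma constraint_le_violation: "i \<in> {1..m} \<Longrightarrow> g i x \<le> violation m g x"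
  unfolding violation_def by (rule order_trans[OF max.cobounded1 Max_ge]) auto

lemma violation_le_iff:
  assumes "1 \<le> m"
  shows "violation m g x \<le> b \<longleftrightarrow> 0 \<le> b \<and> (\<forall>i\<in>{1..m}. g i x \<le> b)"
  using assms unfolding violation_def by (subst Max_le_iff) auto

lemma violation_attained:
  assumes "1 \<le> m"
  obtains i where "i \<in> {1..m}" "violation m g x = max (g i x) 0"
proof -
  have "violation m g x \<in> (\<lambda>i. max (g i x) 0) ` {1..m}"
    unfolding violation_def using assms by (intro Max_in) auto
  then show thesis using that by auto
qed

lemma violation_nonneg: "1 \<le> m \<Longrightarrow> 0 \<le> violation m g x"
  using violation_le_iff[of m g x "violation m g x"] by simp

section \<open>Runs with extrapolation: the steps vanish\<close>

locale esqm_e =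
  fixes P1 P2 :: "'a::euclidean_space \<Rightarrow> real"
    and C :: "'a set"
    and m :: nat
    and g g1 g2 :: "nat \<Rightarrow> 'a \<Rightarrow> real"
    and L l :: "nat \<Rightarrow> real"
    and Lg lg d :: real
    and \<beta> s \<theta> :: "nat \<Rightarrow> real"
    and x y \<xi> :: "nat \<Rightarrow> 'a"
  assumes P1: "convex_on UNIV P1" and P2: "convex_on UNIV P2"
    and compact_C: "compact C" and convex_C: "convex C"
    and m: "1 \<le> m"
    and g_smooth: "\<And>i. i \<in> {1..m} \<Longrightarrow> \<exists>M. lipschitz_gradient M (g i)"
    and g_dc: "\<And>i z. i \<in> {1..m} \<Longrightarrow> g i z = g1 i z - g2 i z"
    and g12_convex: "\<And>i. i \<in> {1..m} \<Longrightarrow> convex_on UNIV (g1 i) \<and> convex_on UNIV (g2 i)"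
    and g12_smooth: "\<And>i. i \<in> {1..m} \<Longrightarrow> lipschitz_gradient (L i) (g1 i) \<and> lipschitz_gradient (l i) (g2 i)"
    and moduli: "\<And>i. i \<in> {1..m} \<Longrightarrow> 0 < L i \<and> 0 \<le> l i \<and> l i \<le> L i"
    and Lg_eq: "Lg = Max (L ` {1..m})" and lg_eq: "lg = Max (l ` {1..m})"
    and A: "assumption_A C m g"
    and run: "ESQM_e_run P1 P2 C m g Lg lg d \<beta> x s y \<xi> \<theta>"
begin

abbreviation viol :: "'a \<Rightarrow> real" where "viol \<equiv> violation m g"

text \<open>
  The displacement that the extrapolation uses; it vanishes for \<open>k = 0\<close> because the iterate
  preceding \<open>x 0\<close> is \<open>x 0\<close>.
\<close>

definition step :: "nat \<Rightarrow> 'a" where "step k = x k - (if k = 0 then x 0 else x (k - 1))"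

lemma step_Suc [simp]: "step (Suc k) = x (Suc k) - x k"
  by (simp add: step_def)

lemma L_le_Lg: "i \<in> {1..m} \<Longrightarrow> L i \<le> Lg"
  unfolding Lg_eq by (intro Max_ge) auto

lemma l_le_lg: "i \<in> {1..m} \<Longrightarrow> l i \<le> lg"
  unfolding lg_eq by (intro Max_ge) auto

lemma Lg_pos: "0 < Lg" and lg_nonneg: "0 \<le> lg"
  using moduli[of 1] L_le_Lg[of 1] l_le_lg[of 1] m by auto

lemma g12_differentiable:
  assumes "i \<in> {1..m}"
  shows "g1 i differentiable (at z)" "g2 i differentiable (at z)"
  using g12_smooth[OF assms] by (auto simp: lipschitz_gradient_def)

lemma lin_constraint_diff:
  assumes i: "i \<in> {1..m}"
  shows "lin (g i) u w = lin (g1 i) u w - lin (g2 i) u w"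
  using lin_diff[OF g12_differentiable[OF i]] g_dc[OF i] by presburger

text \<open>
  In the difference \<open>g1 i - g2 i\<close> the convexity of one part gives its linearisation error a
  favourable sign, so only the smoothness of the other part enters: that of \<open>g2 i\<close>, with modulus
  \<open>lg\<close>, when the linearisation is bounded from above, and that of \<open>g1 i\<close>, with modulus \<open>Lg\<close>, when
  the constraint is.
\<close>

lemma lin_le_constraint:
  assumes i: "i \<in> {1..m}"
  shows "lin (g i) u w \<le> g i u + lg / 2 * (norm (u - w))\<^sup>2"
proof -
  note diff = g12_differentiable[OF i]
  have "lin (g i) u w = lin (g1 i) u w - lin (g2 i) u w" by (rule lin_constraint_diff[OF i])
  moreover have "lin (g1 i) u w \<le> g1 i u"
    using g12_convex[OF i] diff by (intro lin_convex_lower) auto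
  moreover have "g2 i u \<le> lin (g2 i) u w + l i / 2 * (norm (u - w))\<^sup>2"
    using g12_smooth[OF i] by (intro lin_lipschitz_upper) auto
  moreover have "l i / 2 * (norm (u - w))\<^sup>2 \<le> lg / 2 * (norm (u - w))\<^sup>2"
    using l_le_lg[OF i] by (intro mult_right_mono) auto
  ultimately show ?thesis using g_dc[OF i] by simp
qed

lemma constraint_le_lin:
  assumes i: "i \<in> {1..m}"
  shows "g i u \<le> lin (g i) u w + Lg / 2 * (norm (u - w))\<^sup>2"
proof -
  note diff = g12_differentiable[OF i]
  have "lin (g i) u w = lin (g1 i) u w - lin (g2 i) u w" by (rule lin_constraint_diff[OF i])
  moreover have "lin (g2 i) u w \<le> g2 i u"
    using g12_convex[OF i] diff by (intro lin_convex_lower) auto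
  moreover have "g1 i u \<le> lin (g1 i) u w + L i / 2 * (norm (u - w))\<^sup>2"
    using g12_smooth[OF i] by (intro lin_lipschitz_upper) auto
  moreover have "L i / 2 * (norm (u - w))\<^sup>2 \<le> Lg / 2 * (norm (u - w))\<^sup>2"
    using L_le_Lg[OF i] by (intro mult_right_mono) auto
  ultimately show ?thesis using g_dc[OF i] by simp
qed

lemma tendsto_lin_constraint:
  assumes "i \<in> {1..m}" "(u \<longlongrightarrow> u0) F" "(w \<longlongrightarrow> w0) F"
  shows "((\<lambda>k. lin (g i) (u k) (w k)) \<longlongrightarrow> lin (g i) u0 w0) F"
  using g_smooth[OF assms(1)] tendsto_lin assms by blast

lemma d_pos: "0 < d" and x0: "x 0 \<in> C" and \<theta>0: "0 < \<theta> 0"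
  and y_eq: "y k = x k + \<beta> k *\<^sub>R step k"
  and \<xi>: "\<xi> k \<in> subdifferential P2 (x k)"
  and minimizer: "is_arg_min (subproblem_objective P1 Lg (\<theta> k) (\<xi> k) (y k))
                     (\<lambda>p. p \<in> subproblem_feasible C m g (y k)) (x (Suc k), s (Suc k))"
  and \<theta>_Suc: "\<theta> (Suc k) =
            (if \<forall>i\<in>{1..m}. lin (g i) (x (Suc k)) (y k) \<le> 0 then \<theta> k else \<theta> k + d)"
  and \<beta>_sup: "(SUP k. \<beta> k) < sqrt (Lg / (Lg + lg))"
  using run unfolding ESQM_e_run_def step_def by blast+

lemma \<beta>: "0 \<le> \<beta> k" "\<beta> k < sqrt (Lg / (Lg + lg))"
proof -
  have "\<beta> k \<in> {0..<sqrt (Lg / (Lg + lg))}" using run unfolding ESQM_e_run_def by blast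
  then show "0 \<le> \<beta> k" "\<beta> k < sqrt (Lg / (Lg + lg))" by simp_all
qed

lemma x_Suc: "x (Suc k) \<in> C" and s_nonneg: "0 \<le> s (Suc k)"
  and lin_le_s: "i \<in> {1..m} \<Longrightarrow> lin (g i) (x (Suc k)) (y k) \<le> s (Suc k)"
  using minimizer[of k] by (auto simp: is_arg_min_def subproblem_feasible_def)

lemma x_in_C: "x k \<in> C"
  using x0 x_Suc by (cases k) auto

lemma \<theta>_incseq: "incseq \<theta>"
  using d_pos by (intro incseq_SucI) (simp add: \<theta>_Suc)

lemma \<theta>_pos: "0 < \<theta> k"
  using \<theta>0 incseqD[OF \<theta>_incseq, of 0 k] by simp

lemma beta_bound: "\<exists>c>0. \<forall>k. c \<le> Lg / 2 - (Lg + lg) / 2 * (\<beta> k)\<^sup>2"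
proof -
  define b where "b = (SUP k. \<beta> k)"
  have bdd: "bdd_above (range \<beta>)" using \<beta>(2) by (intro bdd_aboveI2) (auto intro: less_imp_le)
  have le: "\<beta> k \<le> b" for k unfolding b_def using bdd by (rule cSUP_upper[rotated]) simp
  then have "0 \<le> b" using \<beta>(1) order_trans by blast
  then have "b\<^sup>2 < (sqrt (Lg / (Lg + lg)))\<^sup>2" using \<beta>_sup unfolding b_def by (intro power_strict_mono) auto
  then have "b\<^sup>2 < Lg / (Lg + lg)" using Lg_pos lg_nonneg by simp
  then have "(Lg + lg) * b\<^sup>2 < Lg" using Lg_pos lg_nonneg by (simp add: field_simps)
  moreover have "(Lg + lg) * (\<beta> k)\<^sup>2 \<le> (Lg + lg) * b\<^sup>2" for k
    using le \<beta>(1) Lg_pos lg_nonneg by (intro mult_left_mono power_mono) auto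
  ultimately show ?thesis
    by (intro exI[of _ "(Lg - (Lg + lg) * b\<^sup>2) / 2"]) (auto simp: diff_divide_distrib)
qed

lemma variational_inequality:
  assumes "z \<in> C" "\<And>i. i \<in> {1..m} \<Longrightarrow> lin (g i) z (y k) \<le> \<tau>" "0 \<le> \<tau> \<or> 0 < s (Suc k)"
  shows "0 \<le> P1 z - P1 (x (Suc k)) - \<xi> k \<bullet> (z - x (Suc k)) + \<theta> k * (\<tau> - s (Suc k))
    + \<theta> k * Lg * ((x (Suc k) - y k) \<bullet> (z - x (Suc k)))"
  using subproblem_variational_inequality[OF P1 convex_C minimizer] assms by blast

lemma P_bdd_below: "\<exists>B. \<forall>u\<in>C. B \<le> P1 u - P2 u"
proof -
  have "continuous_on UNIV P1" "continuous_on UNIV P2"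
    using P1 P2 by (auto intro: convex_on_continuous)
  then have "continuous_on C (\<lambda>u. P1 u - P2 u)"
    by (intro continuous_on_diff) (auto intro: continuous_on_subset)
  then have "bounded ((\<lambda>u. P1 u - P2 u) ` C)"
    using compact_C compact_continuous_image compact_imp_bounded by blast
  then obtain B where "\<forall>u\<in>C. \<bar>P1 u - P2 u\<bar> \<le> B" unfolding bounded_real by auto
  then show ?thesis by (intro exI[of _ "- B"]) (auto dest: abs_le_D2)
qed

text \<open>
  The variational inequality at \<open>z = x k\<close>, with the slack that makes \<open>x k\<close> feasible. The
  three-point identity for the proximal term produces the gain \<open>Lg / 2 \<parallel>step (k + 1)\<parallel>\<^sup>2\<close>. The loss comes from
  \<open>\<parallel>x k - y k\<parallel> = \<beta> k \<parallel>step k\<parallel>\<close>: it is \<open>Lg / 2\<close> times the square from the proximal term, plus \<open>lg / 2\<close>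
  times the square from linearising the constraints. All of this is scaled by \<open>\<theta> k\<close>.
\<close>

lemma descent:
  "P1 (x (Suc k)) - P2 (x (Suc k)) + \<theta> k * viol (x (Suc k)) + \<theta> k * (Lg / 2 * (norm (step (Suc k)))\<^sup>2)
   \<le> P1 (x k) - P2 (x k) + \<theta> k * viol (x k) + \<theta> k * ((Lg + lg) / 2 * (\<beta> k)\<^sup>2 * (norm (step k))\<^sup>2)"
proof -
  define X where "X = x (Suc k)"
  define \<tau> where "\<tau> = viol (x k) + lg / 2 * (norm (x k - y k))\<^sup>2"
  have "0 \<le> \<tau>" using violation_nonneg[OF m, of g "x k"] lg_nonneg by (simp add: \<tau>_def)
  moreover have "lin (g i) (x k) (y k) \<le> \<tau>" if "i \<in> {1..m}" for i
    using lin_le_constraint[OF that, of "x k" "y k"] constraint_le_violation[OF that, of g "x k"]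
    by (simp add: \<tau>_def)
  ultimately have vi: "0 \<le> P1 (x k) - P1 X - \<xi> k \<bullet> (x k - X) + \<theta> k * (\<tau> - s (Suc k))
    + \<theta> k * Lg * ((X - y k) \<bullet> (x k - X))"
    unfolding X_def using variational_inequality[OF x_in_C] by blast
  have three: "(X - y k) \<bullet> (x k - X)
      = ((norm (x k - y k))\<^sup>2 - (norm (X - y k))\<^sup>2 - (norm (X - x k))\<^sup>2) / 2"
    unfolding power2_norm_eq_inner by (simp add: inner_diff_left inner_diff_right inner_commute)
  have "P2 (x k) + \<xi> k \<bullet> (X - x k) \<le> P2 X"
    using \<xi>[of k] unfolding subdifferential_def by blast
  then have sub: "- (\<xi> k \<bullet> (x k - X)) \<le> P2 X - P2 (x k)" by (simp add: inner_diff_right)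
  have "viol X \<le> s (Suc k) + Lg / 2 * (norm (X - y k))\<^sup>2"
    unfolding violation_le_iff[OF m]
  proof safe
    show "0 \<le> s (Suc k) + Lg / 2 * (norm (X - y k))\<^sup>2" using s_nonneg Lg_pos by simp
    fix i assume "i \<in> {1..m}"
    then show "g i X \<le> s (Suc k) + Lg / 2 * (norm (X - y k))\<^sup>2"
      using constraint_le_lin[of i X "y k"] lin_le_s[of i k] by (simp add: X_def)
  qed
  then have "\<theta> k * viol X \<le> \<theta> k * (s (Suc k) + Lg / 2 * (norm (X - y k))\<^sup>2)"
    using \<theta>_pos[of k] by simp
  moreover have "(norm (x k - y k))\<^sup>2 = (\<beta> k)\<^sup>2 * (norm (step k))\<^sup>2"
    by (simp add: y_eq power_mult_distrib)
  moreover have "t * v + t * (Lg / 2 * D) \<le> p - q + p' + t * v' + t * ((Lg + lg) / 2 * n)"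
    if "t * v \<le> t * (r + Lg / 2 * e)" "- j \<le> p'"
      "0 \<le> p - q - j + t * (v' + lg / 2 * n - r) + t * Lg * ((n - e - D) / 2)"
    for t v v' D p q p' n r e j :: real
    using that by (simp add: field_simps)
  ultimately have "\<theta> k * viol X + \<theta> k * (Lg / 2 * (norm (X - x k))\<^sup>2)
      \<le> P1 (x k) - P1 X + (P2 X - P2 (x k)) + \<theta> k * viol (x k)
        + \<theta> k * ((Lg + lg) / 2 * ((\<beta> k)\<^sup>2 * (norm (step k))\<^sup>2))"
    using vi sub unfolding three \<tau>_def by metis
  then show ?thesis unfolding step_Suc X_def[symmetric] by (simp add: mult.assoc)
qed

text \<open>
  Dividing the descent inequality by \<open>\<theta> k\<close> gives a merit function that remains monotone even if
  \<open>\<theta>\<close> grows: the numerator of the quotient by \<open>\<theta> k\<close> is made nonnegative by subtracting a lower bound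
  of \<open>P\<close>, so a larger penalty only lowers it. Its decrease from \<open>k\<close> to \<open>k + 1\<close> is at
  least \<open>c \<parallel>step k\<parallel>\<^sup>2\<close> with a uniform \<open>c > 0\<close> because the \<open>\<beta> k\<close> stay away from the critical value.
\<close>

lemma step_tendsto_0: "step \<longlonglongrightarrow> 0"
proof -
  obtain B where B: "\<And>u. u \<in> C \<Longrightarrow> B \<le> P1 u - P2 u" using P_bdd_below by blast
  obtain c where c: "0 < c" "\<And>k. c \<le> Lg / 2 - (Lg + lg) / 2 * (\<beta> k)\<^sup>2" using beta_bound by blast
  define Q where "Q k = P1 (x k) - P2 (x k) - B" for k
  have Q: "0 \<le> Q k" for k using B[OF x_in_C] by (simp add: Q_def)
  define E where "E k = Q k / \<theta> k + viol (x k) + Lg / 2 * (norm (step k))\<^sup>2" for k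
  have dec: "E (Suc k) \<le> E k - c * (norm (step k))\<^sup>2" for k
  proof -
    have "\<theta> k * (Q (Suc k) / \<theta> k + viol (x (Suc k)) + Lg / 2 * (norm (step (Suc k)))\<^sup>2)
      \<le> \<theta> k * (Q k / \<theta> k + viol (x k) + (Lg + lg) / 2 * (\<beta> k)\<^sup>2 * (norm (step k))\<^sup>2)"
      using descent[of k] \<theta>_pos[of k] by (simp add: Q_def distrib_left)
    then have 1: "Q (Suc k) / \<theta> k + viol (x (Suc k)) + Lg / 2 * (norm (step (Suc k)))\<^sup>2
      \<le> Q k / \<theta> k + viol (x k) + (Lg + lg) / 2 * (\<beta> k)\<^sup>2 * (norm (step k))\<^sup>2"
      using \<theta>_pos[of k] by simp
    have 2: "Q (Suc k) / \<theta> (Suc k) \<le> Q (Suc k) / \<theta> k"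
      using Q \<theta>_pos incseqD[OF \<theta>_incseq, of k "Suc k"] by (intro divide_left_mono) auto
    have 3: "c * (norm (step k))\<^sup>2 \<le> (Lg / 2 - (Lg + lg) / 2 * (\<beta> k)\<^sup>2) * (norm (step k))\<^sup>2"
      using c(2) by (intro mult_right_mono) auto
    show ?thesis using 1 2 3 unfolding E_def left_diff_distrib by linarith
  qed
  have "0 \<le> E k" for k
    using Q \<theta>_pos[of k] violation_nonneg[OF m, of g "x k"] Lg_pos by (simp add: E_def)
  moreover have "decseq E"
  proof (rule decseq_SucI)
    fix k
    have "0 \<le> c * (norm (step k))\<^sup>2" using c(1) by simp
    then show "E (Suc k) \<le> E k" using dec[of k] by linarith
  qed
  ultimately obtain e where e: "E \<longlonglongrightarrow> e" using decseq_convergent[of E 0] by blast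
  have "(\<lambda>k. (E k - E (Suc k)) / c) \<longlonglongrightarrow> (e - e) / c"
    using e c(1) by (intro tendsto_intros LIMSEQ_Suc) auto
  then have lim: "(\<lambda>k. (E k - E (Suc k)) / c) \<longlonglongrightarrow> 0" by simp
  have "(\<lambda>k. (norm (step k))\<^sup>2) \<longlonglongrightarrow> 0"
  proof (rule tendsto_sandwich[OF _ _ tendsto_const lim])
    have "(norm (step k))\<^sup>2 \<le> (E k - E (Suc k)) / c" for k
      using dec[of k] c(1) by (simp add: pos_le_divide_eq mult.commute)
    then show "\<forall>\<^sub>F k in sequentially. (norm (step k))\<^sup>2 \<le> (E k - E (Suc k)) / c" by simp
  qed simp
  then have "(\<lambda>k. norm (step k)) \<longlonglongrightarrow> 0"
    using tendsto_real_sqrt[of "\<lambda>k. (norm (step k))\<^sup>2" 0] by (simp only: real_sqrt_abs real_sqrt_zero abs_norm_cancel)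
  then show ?thesis by (rule tendsto_norm_zero_cancel)
qed

lemma neighbours_tendsto:
  assumes r: "strict_mono (r :: nat \<Rightarrow> nat)" and lim: "(\<lambda>j. x (r j)) \<longlonglongrightarrow> a"
  shows "(\<lambda>j. x (Suc (r j))) \<longlonglongrightarrow> a" "(\<lambda>j. y (r j)) \<longlonglongrightarrow> a"
proof -
  have st: "(\<lambda>j. step (r j)) \<longlonglongrightarrow> 0"
    using LIMSEQ_subseq_LIMSEQ[OF step_tendsto_0 r] by (simp add: o_def)
  have "(\<lambda>j. step (Suc (r j))) \<longlonglongrightarrow> 0"
    using LIMSEQ_subseq_LIMSEQ[OF LIMSEQ_Suc[OF step_tendsto_0] r] by (simp add: o_def)
  then have "(\<lambda>j. x (Suc (r j)) - x (r j)) \<longlonglongrightarrow> 0" by simp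
  from tendsto_add[OF this lim] show "(\<lambda>j. x (Suc (r j))) \<longlonglongrightarrow> a" by simp
  have "(\<lambda>j. \<beta> (r j) *\<^sub>R step (r j)) \<longlonglongrightarrow> 0"
  proof (rule Lim_null_comparison[OF _ tendsto_norm_zero[OF st]], rule always_eventually, rule allI)
    fix j
    have "Lg / (Lg + lg) \<le> 1" using Lg_pos lg_nonneg by simp
    then have "\<beta> (r j) \<le> 1" using \<beta>(2)[of "r j"] real_sqrt_le_1_iff[of "Lg / (Lg + lg)"] by linarith
    then show "norm (\<beta> (r j) *\<^sub>R step (r j)) \<le> norm (step (r j))"
      using \<beta>(1) by (simp add: mult_left_le_one_le)
  qed
  from tendsto_add[OF lim this] show "(\<lambda>j. y (r j)) \<longlonglongrightarrow> a" by (simp add: y_eq)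
qed

section \<open>The penalty parameter stabilises\<close>

text \<open>
  The common consequence of both halves of Assumption A. At a feasible point it is the condition
  \<open>RCQ\<close>. At an infeasible one the alternative for linear forms
  turns the absence of multipliers into a direction that decreases every most violated constraint,
  and a short step in it leaves the other constraints below the violation.
\<close>

lemma decrease_direction:
  assumes a: "a \<in> C"
  shows "\<exists>z\<in>C. \<forall>i\<in>{1..m}. lin (g i) z a < viol a"
proof (cases "a \<in> feasible_set m g")
  case True
  then obtain z where "z \<in> C" "\<forall>i\<in>{1..m}. g i a + gradient (g i) a \<bullet> (z - a) < 0"
    using A a unfolding assumption_A_def RCQ_def by blast
  moreover have "0 \<le> viol a" by (rule violation_nonneg[OF m])
  ultimately show ?thesis unfolding lin_def by (meson order_less_le_trans)
next
  case False
  define I where "I = max_violation_indices m g a"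
  have I_iff: "i \<in> I \<longleftrightarrow> i \<in> {1..m} \<and> g i a = viol a" for i
    by (simp add: I_def max_violation_indices_def violation_def)
  obtain j where j: "j \<in> {1..m}" "viol a = max (g j a) 0" by (rule violation_attained[OF m])
  obtain i where "i \<in> {1..m}" "0 < g i a" using False by (auto simp: feasible_set_def not_le)
  then have "0 < viol a" using constraint_le_violation[of i m g a] by linarith
  then have "j \<in> I" using j by (simp add: I_iff max_def split: if_splits)
  then have I: "finite I" "I \<noteq> {}" by (auto simp: I_def max_violation_indices_def)
  have "\<not> (\<forall>z\<in>C. \<exists>i\<in>I. 0 \<le> gradient (g i) a \<bullet> (z - a))"
  proof
    assume "\<forall>z\<in>C. \<exists>i\<in>I. 0 \<le> gradient (g i) a \<bullet> (z - a)"
    then have "\<exists>c :: nat \<Rightarrow> real. (\<forall>i\<in>I. 0 \<le> c i) \<and> sum c I = 1 \<and>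
        (\<forall>z\<in>C. 0 \<le> (\<Sum>i\<in>I. c i *\<^sub>R gradient (g i) a) \<bullet> (z - a))"
      by (intro linear_forms_alternative[OF I convex_C a]) blast
    moreover have "a \<in> C - feasible_set m g" using a False by blast
    ultimately show False using A unfolding assumption_A_def I_def by blast
  qed
  then obtain z where z: "z \<in> C" "\<And>i. i \<in> I \<Longrightarrow> gradient (g i) a \<bullet> (z - a) < 0"
    by (auto simp: not_le)
  have "\<forall>\<^sub>F t in at_right 0. lin (g i) (a + t *\<^sub>R (z - a)) a < viol a" if i: "i \<in> {1..m}" for i
  proof (cases "i \<in> I")
    case True
    have "\<forall>\<^sub>F t in at_right (0::real). 0 < t" by (rule eventually_at_right_less)
    then show ?thesis
      by eventually_elim (use z(2)[OF True] True in \<open>simp add: lin_def I_iff mult_pos_neg\<close>)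
  next
    case False
    have "((\<lambda>t. g i a + t * (gradient (g i) a \<bullet> (z - a))) \<longlongrightarrow> g i a + 0 * (gradient (g i) a \<bullet> (z - a))) (at_right 0)"
      by (intro tendsto_intros)
    moreover have "g i a < viol a" using False i constraint_le_violation[OF i, of g a] by (auto simp: I_iff)
    ultimately show ?thesis by (simp add: lin_def order_tendstoD(2))
  qed
  then have "\<forall>\<^sub>F t in at_right 0. \<forall>i\<in>{1..m}. lin (g i) (a + t *\<^sub>R (z - a)) a < viol a"
    by (simp add: eventually_ball_finite)
  moreover have "\<forall>\<^sub>F t in at_right (0::real). t \<in> {0<..<1}"
    by (rule eventually_at_right_real) simp
  ultimately have "\<forall>\<^sub>F t in at_right (0::real). t \<in> {0<..<1} \<and> (\<forall>i\<in>{1..m}. lin (g i) (a + t *\<^sub>R (z - a)) a < viol a)"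
    by eventually_elim blast
  from eventually_happens'[OF trivial_limit_at_right_real this]
  obtain t where t: "0 < t" "t < 1" "\<forall>i\<in>{1..m}. lin (g i) (a + t *\<^sub>R (z - a)) a < viol a"
    unfolding greaterThanLessThan_iff by blast
  have "a + t *\<^sub>R (z - a) = (1 - t) *\<^sub>R a + t *\<^sub>R z" by (simp add: algebra_simps)
  also have "\<dots> \<in> C" using convex_C a z(1) t by (intro convexD) auto
  finally show ?thesis using t(3) by blast
qed

lemma continuous_at_P: "isCont P1 a" "isCont P2 a"
proof -
  have "continuous_on UNIV P1" "continuous_on UNIV P2" using P1 P2 by (auto intro: convex_on_continuous)
  then show "isCont P1 a" "isCont P2 a" by (auto simp: continuous_on_eq_continuous_at)
qed

lemma penalty_unbounded:
  assumes "\<not> (\<exists>N. \<forall>k\<ge>N. \<theta> k = \<theta> N)"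
  shows "filterlim \<theta> at_top sequentially"
proof -
  have "\<exists>k. \<theta> 0 + real n * d \<le> \<theta> k" for n
  proof (induction n)
    case (Suc n)
    then obtain k where k: "\<theta> 0 + real n * d \<le> \<theta> k" by blast
    have "\<exists>i\<ge>k. \<theta> (Suc i) \<noteq> \<theta> i"
    proof (rule ccontr)
      assume c: "\<not> (\<exists>i\<ge>k. \<theta> (Suc i) \<noteq> \<theta> i)"
      have "\<theta> i = \<theta> k" if "i \<ge> k" for i
        using that by (induction i rule: dec_induct) (use c in auto)
      then show False using assms by blast
    qed
    then obtain i where i: "i \<ge> k" "\<theta> (Suc i) = \<theta> i + d" by (metis \<theta>_Suc)
    then show ?case using k incseqD[OF \<theta>_incseq i(1)]
      by (intro exI[of _ "Suc i"]) (simp add: algebra_simps)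
  qed (auto intro: exI[of _ 0])
  moreover have "\<exists>n. Z \<le> \<theta> 0 + real n * d" for Z
  proof -
    obtain n where "Z - \<theta> 0 < real n * d" using d_pos reals_Archimedean3 by blast
    then show ?thesis by (intro exI[of _ n]) simp
  qed
  ultimately have "\<exists>k. Z \<le> \<theta> k" for Z by (meson order_trans)
  then show ?thesis unfolding filterlim_at_top eventually_sequentially
    using incseqD[OF \<theta>_incseq] by (meson order_trans)
qed

text \<open>
  If the penalty grew for ever, then along the growing steps, where \<open>s > 0\<close>, a subsequence of the
  iterates would converge to some \<open>a \<in> C\<close>. Divide the variational inequality at a point \<open>z\<close> as in
  \<open>decrease_direction\<close> by \<open>\<theta>\<close>: the objective part disappears because \<open>\<theta>\<close> tends to infinity, the
  proximal part because the steps vanish, and what is left says that the violation of \<open>a\<close> is at most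
  a number \<open>\<tau>\<close> strictly below it.
\<close>

theorem penalty_eventually_constant: "\<exists>N. \<forall>k\<ge>N. \<theta> k = \<theta> N"
proof (rule ccontr)
  assume nc: "\<not> (\<exists>N. \<forall>k\<ge>N. \<theta> k = \<theta> N)"
  have \<theta>_top: "filterlim \<theta> at_top sequentially" using nc by (rule penalty_unbounded)
  define bad where "bad = {k. \<theta> (Suc k) \<noteq> \<theta> k}"
  have "infinite bad"
  proof
    assume "finite bad"
    then obtain N where N: "\<forall>k\<in>bad. k < N" using finite_nat_set_iff_bounded by blast
    have "\<theta> k = \<theta> N" if "N \<le> k" for k
      using that
    proof (induction k rule: dec_induct)
      case (step k)
      then have "k \<notin> bad" using N by auto
      then show ?case using step by (simp add: bad_def)
    qed simp
    then show False using nc by blast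
  qed
  then obtain r0 :: "nat \<Rightarrow> nat" where r0: "strict_mono r0" "\<And>n. r0 n \<in> bad"
    using infinite_enumerate by blast
  obtain a r1 where a: "a \<in> C" and r1: "strict_mono (r1 :: nat \<Rightarrow> nat)" "((x \<circ> r0) \<circ> r1) \<longlonglongrightarrow> a"
    using compact_C x_in_C unfolding compact_def by (metis comp_apply)
  define r where "r = r0 \<circ> r1"
  have r: "strict_mono r" using r0(1) r1(1) unfolding r_def by (rule strict_mono_o)
  have bad: "r j \<in> bad" for j using r0(2) by (simp add: r_def)
  have xr: "(\<lambda>j. x (r j)) \<longlonglongrightarrow> a" using r1(2) by (simp add: r_def o_def)
  note lims = xr neighbours_tendsto[OF r xr]
  have s_pos: "0 < s (Suc (r j))" for j
  proof -
    obtain i where "i \<in> {1..m}" "0 < lin (g i) (x (Suc (r j))) (y (r j))"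
      using bad[of j] unfolding bad_def mem_Collect_eq \<theta>_Suc by (metis not_le)
    then show ?thesis using lin_le_s[of i "r j"] by linarith
  qed
  obtain z where z: "z \<in> C" "\<forall>i\<in>{1..m}. lin (g i) z a < viol a" using decrease_direction[OF a] by blast
  obtain \<tau> where \<tau>: "\<tau> < viol a" "\<forall>i\<in>{1..m}. lin (g i) z a < \<tau>"
  proof -
    define M where "M = Max ((\<lambda>i. lin (g i) z a) ` {1..m})"
    have ne: "(\<lambda>i. lin (g i) z a) ` {1..m} \<noteq> {}" using m by simp
    have "M < viol a" unfolding M_def using z(2) ne by (subst Max_less_iff) auto
    then obtain \<tau> where "M < \<tau>" "\<tau> < viol a" using dense by blast
    moreover have "\<forall>i\<in>{1..m}. lin (g i) z a \<le> M" unfolding M_def by (auto intro: Max_ge)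
    ultimately show thesis using that by fastforce
  qed
  obtain i where i: "i \<in> {1..m}" "viol a = max (g i a) 0" by (rule violation_attained[OF m])
  \<comment> \<open>A lower bound for the slack whose limit is the violation of \<open>a\<close>, because \<open>i\<close> attains the latter.\<close>
  define v where "v j = max (lin (g i) (x (Suc (r j))) (y (r j))) 0" for j
  have v_le: "v j \<le> s (Suc (r j))" for j
    using lin_le_s[OF i(1)] s_nonneg by (simp add: v_def)
  have "v \<longlonglongrightarrow> max (lin (g i) a a) 0"
    unfolding v_def by (intro tendsto_max tendsto_const tendsto_lin_constraint[OF i(1)] lims)
  then have v: "v \<longlonglongrightarrow> viol a" using i(2) by (simp add: lin_def)
  \<comment> \<open>Testing \<open>\<xi> (r j)\<close> at \<open>x (r j) + x (Suc (r j)) - z\<close> bounds its term by convergent values of \<open>P2\<close>.\<close>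
  define n where "n j = P1 z - P1 (x (Suc (r j))) + (P2 (x (r j) + x (Suc (r j)) - z) - P2 (x (r j)))" for j
  have "n \<longlonglongrightarrow> P1 z - P1 a + (P2 (a + a - z) - P2 a)"
    unfolding n_def
    by (intro tendsto_add tendsto_diff tendsto_const isCont_tendsto_compose[OF continuous_at_P(1)]
        isCont_tendsto_compose[OF continuous_at_P(2)] lims)
  moreover have "filterlim (\<lambda>j. \<theta> (r j)) at_infinity sequentially"
    using filterlim_compose[OF \<theta>_top filterlim_subseq[OF r]] by (rule filterlim_at_top_imp_at_infinity)
  ultimately have n: "(\<lambda>j. n j / \<theta> (r j)) \<longlonglongrightarrow> 0" by (rule tendsto_divide_0)
  define e where "e j = Lg * ((x (Suc (r j)) - y (r j)) \<bullet> (z - x (Suc (r j))))" for j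
  have "e \<longlonglongrightarrow> Lg * ((a - a) \<bullet> (z - a))" unfolding e_def by (intro tendsto_intros lims)
  then have e: "e \<longlonglongrightarrow> 0" by simp
  have "\<forall>\<^sub>F j in sequentially. \<forall>i\<in>{1..m}. lin (g i) z (y (r j)) < \<tau>"
  proof (rule eventually_ball_finite)
    show "\<forall>i\<in>{1..m}. \<forall>\<^sub>F j in sequentially. lin (g i) z (y (r j)) < \<tau>"
      using tendsto_lin_constraint[OF _ tendsto_const lims(3)] \<tau>(2) order_tendstoD(2) by blast
  qed simp
  then have "\<forall>\<^sub>F j in sequentially. 0 \<le> n j / \<theta> (r j) + (\<tau> - v j) + e j"
  proof eventually_elim
    case (elim j)
    let ?X = "x (Suc (r j))"
    have "0 \<le> P1 z - P1 ?X - \<xi> (r j) \<bullet> (z - ?X) + \<theta> (r j) * (\<tau> - s (Suc (r j)))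
      + \<theta> (r j) * Lg * ((?X - y (r j)) \<bullet> (z - ?X))"
      using elim s_pos by (intro variational_inequality z(1)) (auto intro: less_imp_le)
    moreover have "- (\<xi> (r j) \<bullet> (z - ?X)) \<le> P2 (x (r j) + ?X - z) - P2 (x (r j))"
    proof -
      have "P2 (x (r j)) + \<xi> (r j) \<bullet> (x (r j) + ?X - z - x (r j)) \<le> P2 (x (r j) + ?X - z)"
        using \<xi>[of "r j"] unfolding subdifferential_def by blast
      then show ?thesis by (simp add: inner_diff_right inner_add_right)
    qed
    moreover have "\<theta> (r j) * (\<tau> - s (Suc (r j))) \<le> \<theta> (r j) * (\<tau> - v j)"
      using v_le[of j] \<theta>_pos[of "r j"] by simp
    ultimately have "0 \<le> n j + \<theta> (r j) * (\<tau> - v j) + \<theta> (r j) * e j"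
      by (simp add: n_def e_def mult.assoc)
    also have "\<dots> = \<theta> (r j) * (n j / \<theta> (r j) + (\<tau> - v j) + e j)"
      using \<theta>_pos[of "r j"] by (simp add: distrib_left)
    finally show ?case using \<theta>_pos[of "r j"] by (simp add: zero_le_mult_iff)
  qed
  moreover have "(\<lambda>j. n j / \<theta> (r j) + (\<tau> - v j) + e j) \<longlonglongrightarrow> 0 + (\<tau> - viol a) + 0"
    by (rule tendsto_add[OF tendsto_add[OF n tendsto_diff[OF tendsto_const v]] e])
  ultimately have "0 \<le> 0 + (\<tau> - viol a) + 0"
    using tendsto_lowerbound trivial_limit_sequentially by blast
  then show False using \<tau>(1) by simp
qed

section \<open>Stationarity of accumulation points\<close>

text \<open>
  Once the penalty is constant, no linearised constraint is positive any more, which in the limit is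
  feasibility. Along a subsequence on which the subgradients of \<open>P2\<close> also converge, the variational
  inequality passes to the limit; its proximal term vanishes with the steps. The strict bound
  \<open>lin (g i) z a < \<tau>\<close> makes \<open>(z, \<tau>)\<close> feasible in all late subproblems.
\<close>

lemma accumulation_point_limits:
  assumes const: "\<forall>k\<ge>N. \<theta> k = \<theta> N" and acc: "accumulation_point x a"
  shows "a \<in> C" "a \<in> feasible_set m g"
    "\<exists>v\<in>subdifferential P2 a. \<forall>z\<in>C. \<forall>\<tau>\<ge>0. (\<forall>i\<in>{1..m}. lin (g i) z a < \<tau>) \<longrightarrow>
       0 \<le> P1 z - P1 a - v \<bullet> (z - a) + \<theta> N * \<tau>"
proof -
  obtain r0 :: "nat \<Rightarrow> nat" where r0: "strict_mono r0" "(x \<circ> r0) \<longlonglongrightarrow> a"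
    using acc unfolding accumulation_point_def by blast
  have "bounded (range (\<lambda>j. \<xi> (r0 j)))"
    using bounded_subgradients[OF P2 compact_C] by (rule bounded_subset) (use \<xi> x_in_C in blast)
  then obtain v r1 where r1: "strict_mono (r1 :: nat \<Rightarrow> nat)" and v: "((\<lambda>j. \<xi> (r0 j)) \<circ> r1) \<longlonglongrightarrow> v"
    using bounded_imp_convergent_subsequence by blast
  define r where "r j = r0 (r1 (j + N))" for j
  have r: "strict_mono r" using r0(1) r1 unfolding r_def strict_mono_def by simp
  have rN: "N \<le> r j" for j
    using strict_mono_imp_increasing[OF r0(1), of "r1 (j + N)"] strict_mono_imp_increasing[OF r1, of "j + N"]
    by (simp add: r_def)
  have xr: "(\<lambda>j. x (r j)) \<longlonglongrightarrow> a"
    using LIMSEQ_ignore_initial_segment[OF LIMSEQ_subseq_LIMSEQ[OF r0(2) r1], of N] by (simp add: r_def o_def)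
  have \<xi>r: "(\<lambda>j. \<xi> (r j)) \<longlonglongrightarrow> v"
    using LIMSEQ_ignore_initial_segment[OF v, of N] by (simp add: r_def o_def)
  note lims = xr neighbours_tendsto[OF r xr]
  show "a \<in> C" using closed_sequentially[OF compact_imp_closed[OF compact_C] _ xr] x_in_C by blast
  have "g i a \<le> 0" if i: "i \<in> {1..m}" for i
  proof -
    have "lin (g i) (x (Suc (r j))) (y (r j)) \<le> 0" for j
    proof (rule ccontr)
      assume "\<not> lin (g i) (x (Suc (r j))) (y (r j)) \<le> 0"
      then have "\<theta> (Suc (r j)) = \<theta> (r j) + d" using i by (auto simp: \<theta>_Suc)
      moreover have "\<theta> (Suc (r j)) = \<theta> N" "\<theta> (r j) = \<theta> N"
        using rN[of j] by (intro const[rule_format]; simp)+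
      ultimately show False using d_pos by simp
    qed
    then have "lin (g i) a a \<le> 0"
      using tendsto_lin_constraint[OF i lims(2,3)] LIMSEQ_le_const2 by blast
    then show ?thesis by (simp add: lin_def)
  qed
  then show "a \<in> feasible_set m g" by (simp add: feasible_set_def)
  have "v \<in> subdifferential P2 a" using P2 xr \<xi>r \<xi> by (rule subdifferential_closed_graph)
  moreover have "0 \<le> P1 z - P1 a - v \<bullet> (z - a) + \<theta> N * \<tau>"
    if z: "z \<in> C" and \<tau>: "0 \<le> \<tau>" "\<forall>i\<in>{1..m}. lin (g i) z a < \<tau>" for z \<tau>
  proof -
    define R where "R j = P1 z - P1 (x (Suc (r j))) - \<xi> (r j) \<bullet> (z - x (Suc (r j))) + \<theta> N * \<tau>
      + \<theta> N * Lg * ((x (Suc (r j)) - y (r j)) \<bullet> (z - x (Suc (r j))))" for j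
    have "\<forall>\<^sub>F j in sequentially. \<forall>i\<in>{1..m}. lin (g i) z (y (r j)) < \<tau>"
    proof (rule eventually_ball_finite)
      show "\<forall>i\<in>{1..m}. \<forall>\<^sub>F j in sequentially. lin (g i) z (y (r j)) < \<tau>"
        using tendsto_lin_constraint[OF _ tendsto_const lims(3)] \<tau>(2) order_tendstoD(2) by blast
    qed simp
    then have "\<forall>\<^sub>F j in sequentially. 0 \<le> R j"
    proof eventually_elim
      case (elim j)
      have "\<theta> (r j) = \<theta> N" using const rN by blast
      moreover have "\<theta> N * (\<tau> - s (Suc (r j))) \<le> \<theta> N * \<tau>"
        using s_nonneg[of "r j"] \<theta>_pos[of N] by simp
      ultimately show ?case
        using variational_inequality[OF z, of "r j" \<tau>] elim \<tau>(1) by (simp add: R_def less_imp_le)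
    qed
    moreover have "R \<longlonglongrightarrow> P1 z - P1 a - v \<bullet> (z - a) + \<theta> N * \<tau> + \<theta> N * Lg * ((a - a) \<bullet> (z - a))"
      unfolding R_def
      by (intro tendsto_intros isCont_tendsto_compose[OF continuous_at_P(1)] lims \<xi>r)
    ultimately have "0 \<le> P1 z - P1 a - v \<bullet> (z - a) + \<theta> N * \<tau> + \<theta> N * Lg * ((a - a) \<bullet> (z - a))"
      using tendsto_lowerbound trivial_limit_sequentially by blast
    then show ?thesis by simp
  qed
  ultimately show "\<exists>v\<in>subdifferential P2 a. \<forall>z\<in>C. \<forall>\<tau>\<ge>0. (\<forall>i\<in>{1..m}. lin (g i) z a < \<tau>) \<longrightarrow>
       0 \<le> P1 z - P1 a - v \<bullet> (z - a) + \<theta> N * \<tau>" by blast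
qed

lemma active_indices_feasible:
  assumes "a \<in> feasible_set m g"
  shows "active_indices m g a = insert 0 {i\<in>{1..m}. g i a = 0}"
proof -
  have "Max ((\<lambda>i. with_zero g i a) ` {0..m}) = 0"
    using assms by (intro Max_eqI) (auto simp: with_zero_def feasible_set_def intro!: image_eqI[of _ _ 0])
  then show ?thesis by (auto simp: active_indices_def with_zero_def)
qed

lemma gradient_with_zero: "gradient (with_zero g i) z = (if i = 0 then 0 else gradient (g i) z)"
proof -
  have "gradient (\<lambda>_. 0) z = (0 :: 'a)" by (rule gradient_eqI) (rule GDERIV_const)
  then show ?thesis by (simp add: with_zero_def)
qed

text \<open>
  The limiting inequality compares \<open>a\<close> with points \<open>z\<close> through all constraints. Applied close to
  \<open>a\<close> on the segment towards \<open>z\<close> it involves only the active ones, since the linearisations of the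
  inactive constraints are still negative there. The result is a minimality property for
  \<open>P1 - v\<close> plus \<open>\<theta> N\<close> times a maximum of linear forms, to which the multiplier lemma applies.
  The zero function among the constraints contributes the zero form and keeps the maximum nonnegative.
\<close>

theorem accumulation_point_multipliers:
  assumes const: "\<forall>k\<ge>N. \<theta> k = \<theta> N" and acc: "accumulation_point x a"
  shows "\<exists>w\<in>subdifferential P1 a. \<exists>v\<in>subdifferential P2 a. \<exists>c :: nat \<Rightarrow> real.
    (\<forall>i\<in>active_indices m g a. 0 \<le> c i) \<and> sum c (active_indices m g a) = 1 \<and>
    - (w - v + \<theta> N *\<^sub>R (\<Sum>i\<in>active_indices m g a. c i *\<^sub>R gradient (with_zero g i) a)) \<in> normal_cone C a"
proof -
  note a = accumulation_point_limits(1,2)[OF assms]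
  obtain v where v: "v \<in> subdifferential P2 a"
    and opt: "\<And>z \<tau>. z \<in> C \<Longrightarrow> 0 \<le> \<tau> \<Longrightarrow> (\<And>i. i \<in> {1..m} \<Longrightarrow> lin (g i) z a < \<tau>) \<Longrightarrow>
       0 \<le> P1 z - P1 a - v \<bullet> (z - a) + \<theta> N * \<tau>"
    using accumulation_point_limits(3)[OF assms] by blast
  define I where "I = active_indices m g a"
  have I_eq: "I = insert 0 {i\<in>{1..m}. g i a = 0}"
    unfolding I_def by (rule active_indices_feasible[OF a(2)])
  then have I: "finite I" "I \<noteq> {}" by auto
  define u where "u i = gradient (with_zero g i) a" for i
  have u0: "u 0 = 0" and u: "i \<in> {1..m} \<Longrightarrow> u i = gradient (g i) a" for i
    by (auto simp: u_def gradient_with_zero)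
  have "0 \<le> P1 z - P1 a - v \<bullet> (z - a) + \<theta> N * Max ((\<lambda>i. u i \<bullet> (z - a)) ` I)" if z: "z \<in> C" for z
  proof (rule field_le_epsilon)
    fix \<epsilon> :: real assume "0 < \<epsilon>"
    \<comment> \<open>The margin \<open>\<delta>\<close> makes the bound on the active linearisations strict; it costs \<open>\<epsilon>\<close> after scaling by \<open>\<theta> N\<close>.\<close>
    define \<delta> where "\<delta> = \<epsilon> / \<theta> N"
    have "0 < \<delta>" using \<open>0 < \<epsilon>\<close> \<theta>_pos by (simp add: \<delta>_def)
    define H where "H = Max ((\<lambda>i. u i \<bullet> (z - a)) ` I)"
    have H: "u i \<bullet> (z - a) \<le> H" if "i \<in> I" for i unfolding H_def using I that by (intro Max_ge) auto
    have "0 \<le> H" using H[of 0] u0 I_eq by simp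
    have "\<forall>\<^sub>F t in at_right 0. lin (g i) (a + t *\<^sub>R (z - a)) a < t * (H + \<delta>)" if i: "i \<in> {1..m}" for i
    proof (cases "i \<in> I")
      case True
      have "\<forall>\<^sub>F t in at_right (0::real). 0 < t" by (rule eventually_at_right_less)
      then show ?thesis
      proof eventually_elim
        case (elim t)
        have "g i a = 0" using True i I_eq by auto
        moreover have "t * (u i \<bullet> (z - a)) < t * (H + \<delta>)" using H[OF True] \<open>0 < \<delta>\<close> elim by simp
        ultimately show ?case by (simp add: lin_def u[OF i])
      qed
    next
      case False
      have "((\<lambda>t. g i a + t * (gradient (g i) a \<bullet> (z - a)) - t * (H + \<delta>)) \<longlongrightarrow>
          g i a + 0 * (gradient (g i) a \<bullet> (z - a)) - 0 * (H + \<delta>)) (at_right 0)"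
        by (intro tendsto_intros)
      moreover have "g i a < 0" using False i a(2) unfolding I_eq feasible_set_def by (auto simp: order.order_iff_strict)
      ultimately have "\<forall>\<^sub>F t in at_right 0. g i a + t * (gradient (g i) a \<bullet> (z - a)) - t * (H + \<delta>) < 0"
        by (intro order_tendstoD(2)) auto
      then show ?thesis by eventually_elim (simp add: lin_def)
    qed
    then have "\<forall>\<^sub>F t in at_right 0. \<forall>i\<in>{1..m}. lin (g i) (a + t *\<^sub>R (z - a)) a < t * (H + \<delta>)"
      by (simp add: eventually_ball_finite)
    moreover have "\<forall>\<^sub>F t in at_right (0::real). t \<in> {0<..<1}"
      by (rule eventually_at_right_real) simp
    ultimately have "\<forall>\<^sub>F t in at_right (0::real). t \<in> {0<..<1} \<and>
        (\<forall>i\<in>{1..m}. lin (g i) (a + t *\<^sub>R (z - a)) a < t * (H + \<delta>))"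
      by eventually_elim blast
    from eventually_happens'[OF trivial_limit_at_right_real this]
    obtain t where t: "0 < t" "t < 1"
      and lt: "\<forall>i\<in>{1..m}. lin (g i) (a + t *\<^sub>R (z - a)) a < t * (H + \<delta>)"
      unfolding greaterThanLessThan_iff by blast
    have eq: "a + t *\<^sub>R (z - a) = (1 - t) *\<^sub>R a + t *\<^sub>R z" by (simp add: algebra_simps)
    have "a + t *\<^sub>R (z - a) \<in> C" unfolding eq using convex_C a(1) z t by (intro convexD) auto
    then have "0 \<le> P1 (a + t *\<^sub>R (z - a)) - P1 a - v \<bullet> (a + t *\<^sub>R (z - a) - a) + \<theta> N * (t * (H + \<delta>))"
      using \<open>0 \<le> H\<close> \<open>0 < \<delta>\<close> t by (intro opt lt[rule_format]) auto
    also have "P1 (a + t *\<^sub>R (z - a)) \<le> (1 - t) * P1 a + t * P1 z"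
      unfolding eq using convex_onD[OF P1, of t a z] t by simp
    finally have "0 \<le> t * (P1 z - P1 a - v \<bullet> (z - a) + \<theta> N * (H + \<delta>))"
      by (simp add: algebra_simps)
    then have "0 \<le> P1 z - P1 a - v \<bullet> (z - a) + \<theta> N * (H + \<delta>)" using t by (simp add: zero_le_mult_iff)
    then show "0 \<le> P1 z - P1 a - v \<bullet> (z - a) + \<theta> N * Max ((\<lambda>i. u i \<bullet> (z - a)) ` I) + \<epsilon>"
      using \<theta>_pos[of N] by (simp add: \<delta>_def H_def distrib_left)
  qed
  then have "\<exists>w\<in>subdifferential P1 a. \<exists>c :: nat \<Rightarrow> real. (\<forall>i\<in>I. 0 \<le> c i) \<and> sum c I = 1 \<and>
    - (w - v + \<theta> N *\<^sub>R (\<Sum>i\<in>I. c i *\<^sub>R u i)) \<in> normal_cone C a"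
    using \<theta>_pos[of N] by (intro penalised_minimum_multipliers[OF P1 convex_C a(1) I]) auto
  then show ?thesis using v unfolding I_def u_def by blast
qed

lemma stationarity_in_sum:
  assumes "w \<in> subdifferential P1 a" "v \<in> subdifferential P2 a" "- (w - v + q) \<in> normal_cone C a"
  shows "0 \<in> minkowski_diff (subdifferential P1 a) (subdifferential P2 a) + {q} + normal_cone C a"
proof -
  have "w - v \<in> minkowski_diff (subdifferential P1 a) (subdifferential P2 a)"
    using assms by (auto simp: minkowski_diff_def)
  then have "(w - v + q) + - (w - v + q) \<in> minkowski_diff (subdifferential P1 a) (subdifferential P2 a) + {q} + normal_cone C a"
    using assms(3) by (intro set_plus_intro) auto
  then show ?thesis by (simp only: add.right_inverse)
qed

text \<open>
  Rescaling by \<open>\<theta> N > 0\<close> turns the convex combination into multipliers. Complementarity holds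
  because at a feasible point an active constraint other than the zero function vanishes.
\<close>

theorem accumulation_point_critical:
  assumes const: "\<forall>k\<ge>N. \<theta> k = \<theta> N" and acc: "accumulation_point x a"
  shows "critical_point P1 P2 C m g a"
proof -
  note a = accumulation_point_limits(1,2)[OF assms]
  let ?I = "active_indices m g a"
  obtain w v c where w: "w \<in> subdifferential P1 a" and v: "v \<in> subdifferential P2 a"
    and c: "\<forall>i\<in>?I. 0 \<le> c i"
    and normal: "- (w - v + \<theta> N *\<^sub>R (\<Sum>i\<in>?I. c i *\<^sub>R gradient (with_zero g i) a)) \<in> normal_cone C a"
    using accumulation_point_multipliers[OF assms] by blast
  define lam where "lam i = (if g i a = 0 then \<theta> N * c i else 0)" for i
  have I: "?I = insert 0 {i\<in>{1..m}. g i a = 0}" by (rule active_indices_feasible[OF a(2)])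
  have "(\<Sum>i=1..m. lam i *\<^sub>R gradient (g i) a) = (\<Sum>i\<in>{i\<in>{1..m}. g i a = 0}. (\<theta> N * c i) *\<^sub>R gradient (g i) a)"
    unfolding lam_def by (intro sum.mono_neutral_cong_right) auto
  also have "\<dots> = \<theta> N *\<^sub>R (\<Sum>i\<in>?I. c i *\<^sub>R gradient (with_zero g i) a)"
    unfolding I by (subst sum.insert) (auto simp: gradient_with_zero scaleR_sum_right intro!: sum.cong)
  finally have "0 \<in> minkowski_diff (subdifferential P1 a) (subdifferential P2 a)
      + {\<Sum>i=1..m. lam i *\<^sub>R gradient (g i) a} + normal_cone C a"
    using stationarity_in_sum[OF w v] normal by metis
  moreover have "0 \<le> lam i \<and> g i a \<le> 0 \<and> lam i * g i a = 0" if "i \<in> {1..m}" for i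
    using that c I a(2) \<theta>_pos[of N] by (auto simp: lam_def feasible_set_def)
  ultimately show ?thesis using a(1) unfolding critical_point_def by blast
qed

end

theorem theorem4p3:
  fixes P1 P2 :: "real ^ 'n \<Rightarrow> real"
    and C :: "(real ^ 'n) set"
    and m :: nat
    and g g1 g2 :: "nat \<Rightarrow> real ^ 'n \<Rightarrow> real"
    and L l :: "nat \<Rightarrow> real"
    and Lg lg d :: real
    and \<beta> s \<theta> :: "nat \<Rightarrow> real"
    and x y \<xi> :: "nat \<Rightarrow> real ^ 'n"
  assumes "convex_on UNIV P1" and "convex_on UNIV P2"
    and "C \<noteq> {}" and "compact C" and "convex C"
    and "1 \<le> m"
    and "\<And>i. i \<in> {1..m} \<Longrightarrow> \<exists>M. lipschitz_gradient M (g i)"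
    and "C \<inter> feasible_set m g \<noteq> {}"
    and "\<And>i z. i \<in> {1..m} \<Longrightarrow> g i z = g1 i z - g2 i z"
    and "\<And>i. i \<in> {1..m} \<Longrightarrow> convex_on UNIV (g1 i) \<and> convex_on UNIV (g2 i)"
    and "\<And>i. i \<in> {1..m} \<Longrightarrow> lipschitz_gradient (L i) (g1 i) \<and> lipschitz_gradient (l i) (g2 i)"
    and "\<And>i. i \<in> {1..m} \<Longrightarrow> 0 < L i \<and> 0 \<le> l i \<and> l i \<le> L i"
    and "Lg = Max (L ` {1..m})" and "lg = Max (l ` {1..m})"
    and "assumption_A C m g"
    and "ESQM_e_run P1 P2 C m g Lg lg d \<beta> x s y \<xi> \<theta>"
  shows "\<exists>N0. (\<forall>k\<ge>N0. \<theta> k = \<theta> N0) \<and>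
           (\<forall>xbar. accumulation_point x xbar \<longrightarrow>
              (\<exists>lam :: nat \<Rightarrow> real.
                 (\<forall>i\<in>active_indices m g xbar. 0 \<le> lam i) \<and>
                 (\<Sum>i\<in>active_indices m g xbar. lam i) = 1 \<and>
                 0 \<in> minkowski_diff (subdifferential P1 xbar) (subdifferential P2 xbar)
                     + {\<theta> N0 *\<^sub>R (\<Sum>i\<in>active_indices m g xbar.
                                    lam i *\<^sub>R gradient (with_zero g i) xbar)}
                     + normal_cone C xbar) \<and>
              critical_point P1 P2 C m g xbar)"
proof -
  interpret esqm_e P1 P2 C m g g1 g2 L l Lg lg d \<beta> s \<theta> x y \<xi>
    by unfold_locales (fact assms)+
  obtain N0 where N0: "\<forall>k\<ge>N0. \<theta> k = \<theta> N0" using penalty_eventually_constant by blast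
  moreover have "\<exists>lam :: nat \<Rightarrow> real.
      (\<forall>i\<in>active_indices m g xbar. 0 \<le> lam i) \<and> (\<Sum>i\<in>active_indices m g xbar. lam i) = 1 \<and>
      0 \<in> minkowski_diff (subdifferential P1 xbar) (subdifferential P2 xbar)
        + {\<theta> N0 *\<^sub>R (\<Sum>i\<in>active_indices m g xbar. lam i *\<^sub>R gradient (with_zero g i) xbar)}
        + normal_cone C xbar" if "accumulation_point x xbar" for xbar
    using accumulation_point_multipliers[OF N0 that] stationarity_in_sum by meson
  ultimately show ?thesis using accumulation_point_critical by blast
qed

end
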